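(* The homeomorphism equivalence relation on $\mathsf{AR}(\mathbb{R}^3)$ is not classifiable by countable structures.
   Context: For a Polish space $X$, $\mathcal{K}(X)$ is the space of compact subsets of $X$ with the Vietoris topology. An absolute retract is a space homeomorphic to a retract of the Hilbert cube. $\mathsf{AR}(X)\subseteq\mathcal{K}(X)$ is the (Borel) set of compact subsets of $X$ that are absolute retracts. The homeomorphism equivalence relation on $B\subseteq\mathcal{K}(X)$ relates $K,L\in B$ iff $K$ and $L$ are homeomorphic. An equivalence relation $E$ on a standard Borel space is classifiable by countable structures if there is a countable relational language $\mathcal{L}$ such that $E$ is Borel reducible to the isomorphism relation of $\mathcal{L}$-structures with underlying set $\mathbb{N}$ (Borel reducible: there is a Borel map $f$ with $xEx'\iff f(x)\,F\,f(x')$). *)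

theory Defs
  imports "HOL-Analysis.Analysis"
begin

definition borel_of :: "'a topology \<Rightarrow> 'a measure" where
  "borel_of T = sigma (topspace T) {U. openin T U}"

text \<open>The Vietoris topology on the hyperspace of compact subsets (its topspace is
  exactly the set of compact subsets, including the empty set).\<close>
definition vietoris :: "'a::topological_space set topology" where
  "vietoris = topology_generated_by
     ({{K. compact K \<and> K \<subseteq> U} | U. open U} \<union>
      {{K. compact K \<and> K \<inter> U \<noteq> {}} | U. open U})"

definition AR_R3 :: "(real^3) set set" where
  "AR_R3 = {K. compact K \<and> AR K}"

text \<open>Structures with universe nat for a countable relational language with
  symbols of type 'l and arities given by ar: the interpretation of r is the set
  of tuples (lists of length ar r) on which M r holds.\<close>
definition struct_space :: "('l \<Rightarrow> nat) \<Rightarrow> ('l \<Rightarrow> nat list \<Rightarrow> bool) set" where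
  "struct_space ar = {M. \<forall>r xs. M r xs \<longrightarrow> length xs = ar r}"

definition struct_measure :: "('l \<Rightarrow> nat) \<Rightarrow> ('l \<Rightarrow> nat list \<Rightarrow> bool) measure" where
  "struct_measure ar = sigma (struct_space ar)
     {{M \<in> struct_space ar. M r xs} | r xs. length xs = ar r}"

definition struct_iso :: "('l \<Rightarrow> nat) \<Rightarrow> ('l \<Rightarrow> nat list \<Rightarrow> bool) \<Rightarrow> ('l \<Rightarrow> nat list \<Rightarrow> bool) \<Rightarrow> bool" where
  "struct_iso ar M N \<longleftrightarrow>
     (\<exists>\<pi>::nat \<Rightarrow> nat. bij \<pi> \<and> (\<forall>r xs. length xs = ar r \<longrightarrow> (M r xs \<longleftrightarrow> N r (map \<pi> xs))))"

definition homeo_AR_R3_borel_reducible :: "('l \<Rightarrow> nat) \<Rightarrow> bool" where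
  "homeo_AR_R3_borel_reducible ar \<longleftrightarrow>
     (\<exists>f. f \<in> measurable (restrict_space (borel_of vietoris) AR_R3) (struct_measure ar) \<and>
          (\<forall>K\<in>AR_R3. \<forall>L\<in>AR_R3. K homeomorphic L \<longleftrightarrow> struct_iso ar (f K) (f L)))"

end

theory Submission
  imports Defs
begin

text \<open>
  To a sequence \<open>x\<close> of reals we attach an absolute retract \<open>hairy_disc x\<close>: a square to which, at the
  point \<open>foot x n = (1/2 ^ (n + 1), tanh (x n), 0)\<close>, a fan of \<open>n + 3\<close> short segments is glued. Removing
  \<open>foot x n\<close> leaves \<open>n + 4\<close> components, so every homeomorphism between two such spaces respects the
  feet and their numbering. If \<open>x n - y n\<close> tends to zero fast, then a shear of the square, acting on
  vertical lines by the Moebius maps \<open>tanh u \<mapsto> tanh (u + d)\<close>, shows that the two spaces are homeomorphic;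
  but for generic \<open>x\<close> and \<open>y\<close> they are not, since some \<open>foot x n\<close> accumulate at the origin while the
  corresponding \<open>foot y n\<close> have several limits.

  Turbulence of the moves \<open>x n \<mapsto> x n + 2 ^ - (n + 2) * tanh (h n)\<close> excludes a classification by
  countable structures. Let \<open>g\<close> be a Borel assignment of structures that are isomorphic along
  moves. For each tuple \<open>b\<close>, the Baire property of analytic sets yields, near a generic point, an open
  set of pairs \<open>(x, h)\<close> on which generically the isomorphism from \<open>g x\<close> to \<open>g (move x h)\<close> sends one fixed
  tuple to \<open>b\<close>. Combining two such isomorphisms with the same \<open>x\<close>, the type of \<open>b\<close> is preserved along
  small moves, which reach a dense subset of a neighbourhood because they can be iterated. Hence
  \<open>b\<close> can be extended by further elements in a back-and-forth construction between \<open>g x\<close> and \<open>g y\<close> for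
  any two generic \<open>x\<close> and \<open>y\<close>, and all these structures are isomorphic.
\<close>

section \<open>Generic points\<close>

text \<open>Stated through the complement: countably many dense open sets whose intersection misses
  \<open>A\<close>. This is the form that the Baire category theorem consumes.\<close>

definition meager :: "'a::topological_space set \<Rightarrow> bool" where
  "meager A \<longleftrightarrow> (\<exists>U::nat \<Rightarrow> 'a set. (\<forall>n. open (U n) \<and> closure (U n) = UNIV) \<and> A \<inter> (\<Inter>n. U n) = {})"

lemma meager_empty [simp]: "meager {}"
  unfolding meager_def by (rule exI[of _ "\<lambda>_. UNIV"]) auto

lemma meager_subset: "meager B \<Longrightarrow> A \<subseteq> B \<Longrightarrow> meager A"
  unfolding meager_def by (elim exE, rule_tac x=U in exI) blast

lemma meager_UN:
  assumes "\<And>i::'i::countable. meager (A i)"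
  shows "meager (\<Union>i. A i)"
proof -
  obtain U where U: "\<And>i n. open (U i (n::nat)) \<and> closure (U i n) = UNIV"
    "\<And>i. A i \<inter> (\<Inter>n. U i n) = {}"
    using assms unfolding meager_def by metis
  \<comment> \<open>One sequence enumerates all pairs \<open>(i, n)\<close>; numbers that code no
    \<open>i\<close> get the default \<open>UNIV\<close>, which is dense and open.\<close>
  define V where "V = (\<lambda>k. case prod_decode k of (i, n) \<Rightarrow> if i \<in> range (to_nat :: 'i \<Rightarrow> nat) then U (from_nat i) n else UNIV)"
  have VU: "V (prod_encode (to_nat i, n)) = U i n" for i n
    by (simp add: V_def)
  have "\<And>k. open (V k) \<and> closure (V k) = UNIV"
    by (auto simp: V_def U split: prod.split)
  moreover have "x \<notin> A i" if "x \<in> (\<Inter>k. V k)" for x i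
  proof -
    have "x \<in> U i n" for n using that VU[of i n] by (metis INT_E UNIV_I)
    then show ?thesis using U(2)[of i] by (metis INT_I IntI empty_iff)
  qed
  then have "(\<Union>i. A i) \<inter> (\<Inter>k. V k) = {}" by auto
  ultimately show ?thesis unfolding meager_def by blast
qed

lemma meager_Un:
  assumes "meager A" "meager B"
  shows "meager (A \<union> B)"
proof -
  have "meager (\<Union>b. if b then A else B)"
    by (rule meager_UN) (simp add: assms)
  then show ?thesis by (rule meager_subset) auto
qed

lemma meager_closed_empty_interior:
  assumes "closed F" "interior F = {}"
  shows "meager F"
  unfolding meager_def
  by (rule exI[of _ "\<lambda>_. - F"]) (use assms in \<open>auto simp: closure_complement\<close>)

text \<open>The filter of comeager sets, so that statements about generic points obey the calculus
  of \<open>eventually\<close>. In a complete metric space the Baire category theorem makes it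
  proper.\<close>

definition generic :: "'a::topological_space filter" where
  "generic = Abs_filter (\<lambda>P. meager {x. \<not> P x})"

lemma eventually_generic: "eventually P generic \<longleftrightarrow> meager {x. \<not> P x}"
  unfolding generic_def
proof (rule eventually_Abs_filter, rule is_filter.intro)
  fix P Q :: "'a \<Rightarrow> bool"
  assume "meager {x. \<not> P x}" "meager {x. \<not> Q x}"
  then have "meager ({x. \<not> P x} \<union> {x. \<not> Q x})" by (rule meager_Un)
  then show "meager {x. \<not> (P x \<and> Q x)}" by (rule meager_subset) auto
next
  fix P Q :: "'a \<Rightarrow> bool"
  assume "\<forall>x. P x \<longrightarrow> Q x" "meager {x. \<not> P x}"
  then show "meager {x. \<not> Q x}" by (auto intro: meager_subset)
qed simp

lemma eventually_generic_countable_all: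
  assumes "\<And>i::'i::countable. eventually (P i) generic"
  shows "eventually (\<lambda>x. \<forall>i. P i x) generic"
proof -
  have "meager (\<Union>i. {x. \<not> P i x})"
    by (rule meager_UN) (use assms in \<open>simp add: eventually_generic\<close>)
  then show ?thesis unfolding eventually_generic by (rule meager_subset) auto
qed

lemma eventually_generic_countable_ball:
  assumes "countable I" "\<And>i. i \<in> I \<Longrightarrow> eventually (P i) generic"
  shows "eventually (\<lambda>x. \<forall>i\<in>I. P i x) generic"
proof (cases "I = {}")
  case False
  have "eventually (\<lambda>x. \<forall>n. P (from_nat_into I n) x) generic"
    by (rule eventually_generic_countable_all) (intro assms(2) from_nat_into False)
  then show ?thesis
  proof eventually_elim
    case (elim x)
    show ?case
    proof
      fix i assume "i \<in> I"
      then show "P i x" using elim[rule_format, of "to_nat_on I i"] assms(1) by simp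
    qed
  qed
qed simp

lemma eventually_generic_dense_open:
  assumes "open U" "closure U = UNIV"
  shows "eventually (\<lambda>x. x \<in> U) generic"
  unfolding eventually_generic meager_def
  by (rule exI[of _ "\<lambda>_. U"]) (use assms in auto)

lemma eventually_genericE:
  fixes P :: "'a::topological_space \<Rightarrow> bool"
  assumes "eventually P generic"
  obtains U :: "nat \<Rightarrow> 'a set" where "\<forall>n. open (U n)" "\<forall>n. closure (U n) = UNIV"
    "\<forall>x. (\<forall>n. x \<in> U n) \<longrightarrow> P x"
proof -
  from assms obtain U where U: "\<forall>n::nat. open (U n) \<and> closure (U n) = UNIV" "{x. \<not> P x} \<inter> (\<Inter>n. U n) = {}"
    unfolding eventually_generic meager_def by (elim exE conjE)
  have "P x" if "\<forall>n. x \<in> U n" for x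
  proof -
    have "x \<in> (\<Inter>n. U n)" using that by simp
    then show ?thesis using U(2) by auto
  qed
  with U(1) show ?thesis by (intro that[of U]) auto
qed

lemma closure_UNIV_iff:
  "closure U = UNIV \<longleftrightarrow> (\<forall>S. open S \<longrightarrow> S \<noteq> {} \<longrightarrow> S \<inter> U \<noteq> {})"
proof
  assume *: "\<forall>S. open S \<longrightarrow> S \<noteq> {} \<longrightarrow> S \<inter> U \<noteq> {}"
  have "- closure U \<inter> U = {}" using closure_subset by blast
  then show "closure U = UNIV" using *[rule_format, of "- closure U"] by auto
qed (use open_Int_closure_eq_empty in fastforce)

text \<open>The image of a nonempty open set is open, hence meets every dense open set; so preimages
  of dense open sets stay dense.\<close>

lemma eventually_generic_open_map:
  fixes \<phi> :: "'a::topological_space \<Rightarrow> 'b::topological_space"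
  assumes P: "eventually P generic" and cont: "continuous_on UNIV \<phi>"
    and op: "\<And>S. open S \<Longrightarrow> open (\<phi> ` S)"
  shows "eventually (\<lambda>x. P (\<phi> x)) generic"
proof -
  from P obtain U where U: "\<forall>n::nat. open (U n)" "\<forall>n. closure (U n) = UNIV" "\<forall>x. (\<forall>n. x \<in> U n) \<longrightarrow> P x"
    by (rule eventually_genericE)
  have "eventually (\<lambda>x. x \<in> \<phi> -` U n) generic" for n
  proof (rule eventually_generic_dense_open)
    show "open (\<phi> -` U n)" using cont U(1) by (simp add: continuous_on_open_vimage)
    show "closure (\<phi> -` U n) = UNIV"
      unfolding closure_UNIV_iff
    proof (intro allI impI)
      fix S :: "'a set" assume S: "open S" "S \<noteq> {}"
      then have "\<phi> ` S \<inter> U n \<noteq> {}"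
        using U(2)[rule_format, of n] op[OF S(1)] unfolding closure_UNIV_iff by blast
      then show "S \<inter> \<phi> -` U n \<noteq> {}" by blast
    qed
  qed
  then have "eventually (\<lambda>x. \<forall>n. x \<in> \<phi> -` U n) generic" by (rule eventually_generic_countable_all)
  then show ?thesis by eventually_elim (use U(3) in auto)
qed

lemma eventually_generic_homeomorphism:
  fixes \<phi> :: "'a::topological_space \<Rightarrow> 'b::topological_space"
  assumes P: "eventually P generic" and "continuous_on UNIV \<phi>" "continuous_on UNIV \<psi>"
    and inv: "\<And>x. \<psi> (\<phi> x) = x" "\<And>y. \<phi> (\<psi> y) = y"
  shows "eventually (\<lambda>x. P (\<phi> x)) generic"
proof (rule eventually_generic_open_map[OF P assms(2)])
  fix S :: "'a set" assume "open S"
  moreover have "\<phi> ` S = \<psi> -` S" using inv by (auto simp: image_iff) metis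
  ultimately show "open (\<phi> ` S)" using assms(3) by (simp add: continuous_on_open_vimage)
qed

lemma eventually_generic_fst:
  assumes "eventually P generic"
  shows "eventually (\<lambda>z. P (fst z)) generic"
  by (rule eventually_generic_open_map[OF assms]) (auto intro: continuous_intros open_image_fst)

text \<open>The Baire category theorem, in the form that produces actual points from generic
  statements.\<close>

lemma generic_exists_in_open:
  fixes P :: "'a::complete_space \<Rightarrow> bool"
  assumes P: "eventually P generic" and S: "open S" "S \<noteq> {}"
  obtains x where "x \<in> S" "P x"
proof -
  from P obtain U where U: "\<forall>n::nat. open (U n)" "\<forall>n. closure (U n) = UNIV" "\<forall>x. (\<forall>n. x \<in> U n) \<longrightarrow> P x"
    by (rule eventually_genericE)
  have "euclidean closure_of (\<Inter>(range U)) = topspace (euclidean :: 'a topology)"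
    by (rule Baire_category) (use U completely_metrizable_space_euclidean in auto)
  then have "closure (\<Inter>(range U)) = UNIV" by simp
  then obtain x where "x \<in> S" "x \<in> \<Inter>(range U)" using S unfolding closure_UNIV_iff by blast
  then show ?thesis using that U(3) by blast
qed

text \<open>For a dense open set \<open>U n\<close> and a nonempty basic open \<open>V\<close>, the
  projection of \<open>U n \<inter> UNIV \<times> V\<close> is dense and open. A point in all of
  these countably many projections has dense open sections.\<close>

theorem Kuratowski_Ulam:
  fixes P :: "'a::topological_space \<times> 'b::second_countable_topology \<Rightarrow> bool"
  assumes "eventually P generic"
  shows "eventually (\<lambda>x. eventually (\<lambda>y. P (x, y)) generic) generic"
proof -
  from assms obtain U where U: "\<forall>n::nat. open (U n)" "\<forall>n. closure (U n) = UNIV" "\<forall>x. (\<forall>n. x \<in> U n) \<longrightarrow> P x"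
    by (rule eventually_genericE)
  obtain B :: "'b set set" where B: "countable B" "topological_basis B"
    using ex_countable_basis by blast
  have dense: "eventually (\<lambda>x. x \<in> fst ` (U n \<inter> UNIV \<times> V)) generic" if V: "V \<in> B" "V \<noteq> {}" for n V
  proof (rule eventually_generic_dense_open)
    have oV: "open V" using B V topological_basis_open by blast
    show "open (fst ` (U n \<inter> UNIV \<times> V))"
      by (intro open_image_fst open_Int U[rule_format] open_Times oV open_UNIV)
    show "closure (fst ` (U n \<inter> UNIV \<times> V)) = UNIV"
      unfolding closure_UNIV_iff
    proof (intro allI impI)
      fix S :: "'a set" assume S: "open S" "S \<noteq> {}"
      have "(S \<times> V) \<inter> U n \<noteq> {}"
        using U(2)[rule_format, of n] open_Times[OF S(1) oV] S V unfolding closure_UNIV_iff by blast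
      then show "S \<inter> fst ` (U n \<inter> UNIV \<times> V) \<noteq> {}" by force
    qed
  qed
  have "eventually (\<lambda>x. \<forall>n. \<forall>V\<in>B - {{}}. x \<in> fst ` (U n \<inter> UNIV \<times> V)) generic"
    by (intro eventually_generic_countable_all eventually_generic_countable_ball dense countable_Diff B) auto
  then show ?thesis
  proof eventually_elim
    case (elim x)
    have "eventually (\<lambda>y. y \<in> Pair x -` U n) generic" for n
    proof (rule eventually_generic_dense_open)
      show "open (Pair x -` U n)"
        by (rule open_vimage[OF U(1)[rule_format]]) (intro continuous_intros)
      show "closure (Pair x -` U n) = UNIV"
        unfolding closure_UNIV_iff
      proof (intro allI impI)
        fix S :: "'b set" assume "open S" "S \<noteq> {}"
        then obtain V where V: "V \<in> B" "V \<subseteq> S" "V \<noteq> {}"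
          using B(2) by (metis ex_in_conv topological_basisE empty_iff)
        then have "x \<in> fst ` (U n \<inter> UNIV \<times> V)" using elim by blast
        then show "S \<inter> Pair x -` U n \<noteq> {}" using V by auto
      qed
    qed
    then have "eventually (\<lambda>y. \<forall>n. y \<in> Pair x -` U n) generic"
      by (rule eventually_generic_countable_all)
    then show ?case by eventually_elim (use U(3) in auto)
  qed
qed

section \<open>The Baire property of Borel and analytic sets\<close>

lemma closed_frontier_meager:
  assumes "open U" shows "meager (closure U - U)"
proof (rule meager_closed_empty_interior)
  have "closure U - U = frontier U" using assms by (simp add: frontier_def interior_open)
  then show "closed (closure U - U)" by simp
  show "interior (closure U - U) = {}"
  proof (rule ccontr)
    assume "interior (closure U - U) \<noteq> {}"
    then obtain x where x: "x \<in> interior (closure U - U)" by blast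
    then have "x \<in> closure U" using interior_subset by blast
    then have "interior (closure U - U) \<inter> U \<noteq> {}"
      using x open_Int_closure_eq_empty[OF open_interior, of "closure U - U" U] by blast
    then show False using interior_subset by blast
  qed
qed

lemma eventually_generic_not_frontier:
  "open U \<Longrightarrow> eventually (\<lambda>x. x \<notin> closure U - U) generic"
  unfolding eventually_generic not_not Collect_mem_eq by (rule closed_frontier_meager)

text \<open>Induction over the generated sigma-algebra. For complements, \<open>- closure U\<close>
  replaces \<open>U\<close>, and the additional error is the meager frontier of
  \<open>U\<close>.\<close>

theorem borel_Baire_property:
  assumes "A \<in> sets borel"
  shows "\<exists>U. open U \<and> eventually (\<lambda>x. x \<in> A \<longleftrightarrow> x \<in> U) generic"
proof -
  have "A \<in> sigma_sets UNIV {S. open S}" using assms by (simp add: borel_def)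
  then show ?thesis
  proof (induction rule: sigma_sets.induct)
    case (Compl A)
    then obtain U where U: "open U" "eventually (\<lambda>x. x \<in> A \<longleftrightarrow> x \<in> U) generic" by blast
    have "eventually (\<lambda>x. x \<notin> closure U - U) generic"
      by (rule eventually_generic_not_frontier[OF U(1)])
    with U(2) have "eventually (\<lambda>x. x \<in> UNIV - A \<longleftrightarrow> x \<in> - closure U) generic"
      by eventually_elim (use closure_subset[of U] in auto)
    then show ?case by blast
  next
    case (Union A)
    then obtain U where U: "\<And>i::nat. open (U i)" "\<And>i. eventually (\<lambda>x. x \<in> A i \<longleftrightarrow> x \<in> U i) generic"
      by metis
    from eventually_generic_countable_all[OF U(2)]
    have "eventually (\<lambda>x. x \<in> (\<Union>i. A i) \<longleftrightarrow> x \<in> (\<Union>i. U i)) generic"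
      by eventually_elim auto
    then show ?case using U(1) by blast
  qed (auto intro: exI[of _ "{}"])
qed

text \<open>Off the frontiers, a point lies in the open set \<open>U i\<close> or in its open
  exterior, and either one decides membership in \<open>A i\<close> for all nearby points of
  \<open>C\<close>.\<close>

lemma borel_generically_locally_constant:
  fixes A :: "'i::countable \<Rightarrow> 'a::topological_space set"
  assumes "\<And>i. A i \<in> sets borel"
  obtains C where "eventually (\<lambda>x. x \<in> C) generic"
    "\<And>x i. x \<in> C \<Longrightarrow> \<exists>U. open U \<and> x \<in> U \<and> (\<forall>y\<in>U \<inter> C. y \<in> A i \<longleftrightarrow> x \<in> A i)"
proof -
  obtain U where U: "\<And>i. open (U i)" "\<And>i. eventually (\<lambda>x. x \<in> A i \<longleftrightarrow> x \<in> U i) generic"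
    using borel_Baire_property[OF assms] by metis
  define C where "C = {x. \<forall>i. (x \<in> A i \<longleftrightarrow> x \<in> U i) \<and> x \<notin> closure (U i) - U i}"
  have "eventually (\<lambda>x. x \<in> C) generic"
    unfolding C_def mem_Collect_eq
    by (intro eventually_generic_countable_all eventually_conj U eventually_generic_not_frontier)
  moreover have "\<exists>V. open V \<and> x \<in> V \<and> (\<forall>y\<in>V \<inter> C. y \<in> A i \<longleftrightarrow> x \<in> A i)" if x: "x \<in> C" for x i
  proof (cases "x \<in> A i")
    case True
    then show ?thesis using U(1) x by (intro exI[of _ "U i"]) (auto simp: C_def)
  next
    case False
    then show ?thesis using x closure_subset
      by (intro exI[of _ "- closure (U i)"]) (fastforce simp: C_def)
  qed
  ultimately show ?thesis using that by blast
qed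

text \<open>The part of the Baire property of analytic sets that is needed, for a Suslin scheme \<open>A\<close>.\<close>
theorem generic_branch:
  fixes A :: "nat list \<Rightarrow> 'a::second_countable_topology set"
  assumes split: "\<And>s. A s \<subseteq> (\<Union>k. A (s @ [k]))" and S: "open S" and nonmeager: "\<not> meager (A [] \<inter> S)"
  obtains W where "open W" "W \<noteq> {}" "W \<subseteq> S"
    "eventually (\<lambda>z. z \<in> W \<longrightarrow> (\<exists>\<nu>. \<forall>n. z \<in> closure (A (map \<nu> [0..<n])))) generic"
proof -
  obtain B :: "'a set set" where B: "countable B" "topological_basis B"
    using ex_countable_basis by blast
  \<comment> \<open>The largest open set in all of whose nonempty open subsets \<open>M\<close> is
    nonmeager.\<close>
  define V where "V M = \<Union>{U. open U \<and> (\<forall>U'. open U' \<longrightarrow> U' \<noteq> {} \<longrightarrow> U' \<subseteq> U \<longrightarrow> \<not> meager (M \<inter> U'))}" for M :: "'a set"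
  have oV: "open (V M)" for M unfolding V_def by blast
  have V_nonmeager: "\<not> meager (M \<inter> U)" if U: "open U" "U \<noteq> {}" "U \<subseteq> V M" for U M
  proof -
    obtain x where x: "x \<in> U" using U(2) by blast
    then have "x \<in> V M" using U(3) by blast
    then obtain U' where U': "x \<in> U'" "open U'"
      "\<forall>T. open T \<longrightarrow> T \<noteq> {} \<longrightarrow> T \<subseteq> U' \<longrightarrow> \<not> meager (M \<inter> T)"
      unfolding V_def by (elim UnionE CollectE conjE)
    have "U \<inter> U' \<noteq> {}" using x U'(1) by blast
    then have "\<not> meager (M \<inter> (U \<inter> U'))" using U' open_Int[OF U(1) U'(2)] by blast
    then show ?thesis by (meson Int_lower1 Int_mono meager_subset order_refl)
  qed
  have V_closure: "V M \<subseteq> closure M" for M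
  proof
    fix x assume x: "x \<in> V M"
    show "x \<in> closure M"
    proof (rule ccontr)
      assume "x \<notin> closure M"
      then have "\<not> meager (M \<inter> (V M \<inter> - closure M))"
        using x oV by (intro V_nonmeager) auto
      moreover have "M \<inter> (V M \<inter> - closure M) = {}" using closure_subset by blast
      ultimately show False by simp
    qed
  qed
  \<comment> \<open>Otherwise the basic sets in which \<open>M\<close> is meager are dense in
    \<open>U\<close>. There are countably many of them, so \<open>M\<close> is meager in their union
    \<open>D\<close>, and what remains of \<open>U\<close> lies in the frontier of
    \<open>D\<close>.\<close>
  have meets: "V M \<inter> U \<noteq> {}" if U: "open U" "\<not> meager (M \<inter> U)" for M U
  proof
    assume e: "V M \<inter> U = {}"
    define D where "D = \<Union>{T\<in>B. meager (M \<inter> T)}"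
    have "meager (\<Union>T\<in>{T\<in>B. meager (M \<inter> T)}. M \<inter> T)"
    proof -
      have "eventually (\<lambda>x. \<forall>T\<in>{T\<in>B. meager (M \<inter> T)}. \<not> (x \<in> M \<inter> T)) generic"
      proof (rule eventually_generic_countable_ball)
        show "countable {T\<in>B. meager (M \<inter> T)}" by (rule countable_subset[OF _ B(1)]) auto
      qed (simp only: eventually_generic not_not Collect_mem_eq mem_Collect_eq)
      then show ?thesis unfolding eventually_generic by (rule meager_subset) auto
    qed
    then have MD: "meager (M \<inter> D)" by (rule meager_subset) (auto simp: D_def)
    have oD: "open D" unfolding D_def using B(2) topological_basis_open by blast
    have "U \<subseteq> closure D"
    proof
      fix x assume x: "x \<in> U"
      show "x \<in> closure D"
      proof (rule ccontr)
        assume nx: "x \<notin> closure D"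
        have "x \<notin> V M" using e x by blast
        then obtain T where T: "open T" "T \<noteq> {}" "T \<subseteq> U \<inter> - closure D" "meager (M \<inter> T)"
          unfolding V_def using x nx U(1) open_Int[of U "- closure D"] by blast
        obtain T' where "T' \<in> B" "T' \<subseteq> T" "T' \<noteq> {}"
          using T B(2) by (metis ex_in_conv topological_basisE empty_iff)
        then have "T' \<subseteq> D" using T(4) meager_subset[of "M \<inter> T" "M \<inter> T'"] unfolding D_def by blast
        then show False using T(3) \<open>T' \<subseteq> T\<close> \<open>T' \<noteq> {}\<close> closure_subset by blast
      qed
    qed
    then have "M \<inter> U \<subseteq> (M \<inter> D) \<union> (closure D - D)" by blast
    then have "meager (M \<inter> U)" using meager_Un[OF MD closed_frontier_meager[OF oD]] meager_subset by blast
    then show False using U(2) by blast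
  qed
  define Y where "Y s = (\<Union>k. V (A (s @ [k])))" for s
  have oY: "open (Y s)" for s unfolding Y_def using oV by blast
  have dense: "V (A s) \<subseteq> closure (Y s)" for s
  proof
    fix x assume x: "x \<in> V (A s)"
    show "x \<in> closure (Y s)"
    proof (rule ccontr)
      assume nx: "x \<notin> closure (Y s)"
      let ?U = "V (A s) \<inter> - closure (Y s)"
      have oU: "open ?U" using oV by auto
      have "\<not> meager (A s \<inter> ?U)" using x nx oU by (intro V_nonmeager) auto
      then have "\<not> meager (\<Union>k. A (s @ [k]) \<inter> ?U)"
        using split[of s] meager_subset[of "\<Union>k. A (s @ [k]) \<inter> ?U" "A s \<inter> ?U"] by blast
      then obtain k where "\<not> meager (A (s @ [k]) \<inter> ?U)"
        using meager_UN[of "\<lambda>k. A (s @ [k]) \<inter> ?U"] by (auto simp del: Int_iff)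
      then have "V (A (s @ [k])) \<inter> ?U \<noteq> {}" using meets oU by blast
      then show False using closure_subset[of "Y s"] unfolding Y_def by blast
    qed
  qed
  \<comment> \<open>The exceptional points lie in the meager frontier of \<open>Y s\<close>, and
    there are only countably many \<open>s\<close>. So at a generic \<open>z\<close>, whenever
    \<open>V (A s)\<close> contains \<open>z\<close>, some child of \<open>s\<close> has this
    property too.\<close>
  have "eventually (\<lambda>z. z \<in> V (A s) \<longrightarrow> z \<in> Y s) generic" for s
    using closed_frontier_meager[OF oY, of s] unfolding eventually_generic
    by (rule meager_subset) (use dense in auto)
  then have "eventually (\<lambda>z. \<forall>s. z \<in> V (A s) \<longrightarrow> z \<in> Y s) generic"
    by (rule eventually_generic_countable_all)
  then have "eventually (\<lambda>z. z \<in> V (A []) \<inter> S \<longrightarrow> (\<exists>\<nu>. \<forall>n. z \<in> closure (A (map \<nu> [0..<n])))) generic"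
  proof eventually_elim
    case (elim z)
    show ?case
    proof
      assume z: "z \<in> V (A []) \<inter> S"
      \<comment> \<open>Descend from child to child; the lists \<open>\<sigma> n\<close> are the
        initial segments of the branch \<open>\<nu>\<close>.\<close>
      define nxt where "nxt s = s @ [SOME k. z \<in> V (A (s @ [k]))]" for s
      define \<sigma> where "\<sigma> n = (nxt ^^ n) []" for n
      define \<nu> where "\<nu> n = \<sigma> (Suc n) ! n" for n
      have sz: "z \<in> V (A (\<sigma> n))" for n
      proof (induction n)
        case (Suc n)
        then have "\<exists>k. z \<in> V (A (\<sigma> n @ [k]))" using elim unfolding Y_def by blast
        then have "z \<in> V (A (\<sigma> n @ [SOME k. z \<in> V (A (\<sigma> n @ [k]))]))" by (rule someI_ex)
        then show ?case by (simp add: \<sigma>_def nxt_def)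
      qed (use z in \<open>simp add: \<sigma>_def\<close>)
      have len: "length (\<sigma> n) = n" for n
        by (induction n) (simp_all add: \<sigma>_def nxt_def)
      have "\<sigma> n = map \<nu> [0..<n]" for n
      proof (induction n)
        case (Suc n)
        have "\<sigma> (Suc n) = \<sigma> n @ [\<nu> n]"
          using len[of n] by (simp add: \<nu>_def \<sigma>_def nxt_def nth_append)
        then show ?case using Suc by simp
      qed (simp add: \<sigma>_def)
      then show "\<exists>\<nu>. \<forall>n. z \<in> closure (A (map \<nu> [0..<n]))" using sz V_closure by (metis subsetD)
    qed
  qed
  then show ?thesis
    using that[of "V (A []) \<inter> S"] meets[OF S nonmeager] oV S by blast
qed

section \<open>Tuples and back-and-forth\<close>

definition iso_via :: "('l \<Rightarrow> nat) \<Rightarrow> ('l \<Rightarrow> nat list \<Rightarrow> bool) \<Rightarrow> ('l \<Rightarrow> nat list \<Rightarrow> bool) \<Rightarrow> (nat \<Rightarrow> nat) \<Rightarrow> bool" where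
  "iso_via ar M N \<pi> \<longleftrightarrow> bij \<pi> \<and> (\<forall>r xs. length xs = ar r \<longrightarrow> (M r xs \<longleftrightarrow> N r (map \<pi> xs)))"

text \<open>Plays the role of equality of infinitary types: the two tuples lie in one orbit under
  isomorphisms.\<close>

definition tuple_iso :: "('l \<Rightarrow> nat) \<Rightarrow> ('l \<Rightarrow> nat list \<Rightarrow> bool) \<Rightarrow> nat list \<Rightarrow> ('l \<Rightarrow> nat list \<Rightarrow> bool) \<Rightarrow> nat list \<Rightarrow> bool" where
  "tuple_iso ar M a N b \<longleftrightarrow> (\<exists>\<pi>. iso_via ar M N \<pi> \<and> map \<pi> a = b)"

lemma struct_iso_iff_iso_via: "struct_iso ar M N \<longleftrightarrow> (\<exists>\<pi>. iso_via ar M N \<pi>)"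
  by (simp add: struct_iso_def iso_via_def)

lemma iso_via_id: "iso_via ar M M id"
  by (simp add: iso_via_def)

lemma iso_via_inv:
  assumes "iso_via ar M N \<pi>" shows "iso_via ar N M (inv \<pi>)"
proof -
  have b: "bij \<pi>" and h: "\<And>r xs. length xs = ar r \<Longrightarrow> M r xs \<longleftrightarrow> N r (map \<pi> xs)"
    using assms by (auto simp: iso_via_def)
  have "map \<pi> (map (inv \<pi>) xs) = xs" for xs
    using b by (simp add: bij_is_surj surj_f_inv_f map_idI)
  then show ?thesis using b h[of "map (inv \<pi>) _"] by (simp add: iso_via_def bij_imp_bij_inv)
qed

lemma iso_via_comp:
  assumes "iso_via ar M N \<pi>" "iso_via ar N K \<rho>" shows "iso_via ar M K (\<rho> \<circ> \<pi>)"
  using assms by (auto simp: iso_via_def bij_comp)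

lemma tuple_iso_refl: "tuple_iso ar M a M a"
  unfolding tuple_iso_def using iso_via_id[of ar M] by force

lemma tuple_iso_sym:
  assumes "tuple_iso ar M a N b" shows "tuple_iso ar N b M a"
proof -
  obtain \<pi> where \<pi>: "iso_via ar M N \<pi>" "map \<pi> a = b" using assms tuple_iso_def by metis
  then have "map (inv \<pi>) b = a"
    by (auto simp: iso_via_def bij_is_inj inv_o_cancel)
  with iso_via_inv[OF \<pi>(1)] show ?thesis using tuple_iso_def by metis
qed

lemma tuple_iso_trans:
  assumes "tuple_iso ar M a N b" "tuple_iso ar N b K c" shows "tuple_iso ar M a K c"
proof -
  obtain \<pi> \<rho> where "iso_via ar M N \<pi>" "map \<pi> a = b" "iso_via ar N K \<rho>" "map \<rho> b = c"
    using assms tuple_iso_def by metis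
  then have "iso_via ar M K (\<rho> \<circ> \<pi>)" "map (\<rho> \<circ> \<pi>) a = c" by (auto intro: iso_via_comp)
  then show ?thesis using tuple_iso_def by metis
qed

lemma tuple_iso_extend:
  assumes "tuple_iso ar M a N b" obtains d where "tuple_iso ar M (a @ [c]) N (b @ [d])"
proof -
  obtain \<pi> where "iso_via ar M N \<pi>" "map \<pi> a = b" using assms tuple_iso_def by metis
  then have "tuple_iso ar M (a @ [c]) N (b @ [\<pi> c])" unfolding tuple_iso_def by auto
  then show ?thesis by (rule that)
qed

lemma struct_iso_imp_tuple_iso:
  assumes "struct_iso ar M N" obtains a where "tuple_iso ar M a N b"
proof -
  obtain \<pi> where \<pi>: "iso_via ar M N \<pi>" using assms by (auto simp: struct_iso_iff_iso_via)
  then have "map \<pi> (map (inv \<pi>) b) = b" by (simp add: iso_via_def bij_is_surj surj_f_inv_f map_idI)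
  then show ?thesis using that[of "map (inv \<pi>) b"] \<pi> unfolding tuple_iso_def by blast
qed

lemma tuple_iso_length: "tuple_iso ar M a N b \<Longrightarrow> length a = length b"
  by (auto simp: tuple_iso_def)

lemma tuple_iso_nth_eq_iff:
  assumes "tuple_iso ar M a N b" "i < length a" "j < length a"
  shows "a ! i = a ! j \<longleftrightarrow> b ! i = b ! j"
  using assms by (auto simp: tuple_iso_def iso_via_def bij_is_inj inj_eq)

text \<open>\<open>js\<close> lists variable indices, so \<open>map ((!) a) js\<close> is the
  substitution of the tuple \<open>a\<close> into an atomic formula.\<close>

lemma tuple_iso_atomic:
  assumes "tuple_iso ar M a N b" "\<forall>i\<in>set js. i < length a" "length js = ar r"
  shows "M r (map ((!) a) js) \<longleftrightarrow> N r (map ((!) b) js)"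
proof -
  obtain \<pi> where \<pi>: "iso_via ar M N \<pi>" "map \<pi> a = b" using assms tuple_iso_def by metis
  have "map \<pi> (map ((!) a) js) = map ((!) b) js"
    using assms(2) \<pi>(2) by auto
  then show ?thesis using \<pi>(1) assms(3) by (metis iso_via_def length_map)
qed

text \<open>The pairs of lists are graphs of finite partial isomorphisms, with repetitions allowed;
  \<open>eq\<close> makes these well defined and injective.\<close>

lemma back_and_forth:
  fixes R :: "nat list \<Rightarrow> nat list \<Rightarrow> bool"
  assumes nil: "R [] []"
    and forth: "\<And>p q c. R p q \<Longrightarrow> \<exists>d. R (p @ [c]) (q @ [d])"
    and bwd: "\<And>p q d. R p q \<Longrightarrow> \<exists>c. R (p @ [c]) (q @ [d])"
    and len: "\<And>p q. R p q \<Longrightarrow> length p = length q"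
    and eq: "\<And>p q i j. R p q \<Longrightarrow> i < length p \<Longrightarrow> j < length p \<Longrightarrow> p ! i = p ! j \<longleftrightarrow> q ! i = q ! j"
    and atomic: "\<And>p q js r. R p q \<Longrightarrow> \<forall>i\<in>set js. i < length p \<Longrightarrow> length js = ar r \<Longrightarrow>
       M r (map ((!) p) js) \<longleftrightarrow> N r (map ((!) q) js)"
  shows "struct_iso ar M N"
proof -
  \<comment> \<open>Stage \<open>n\<close> puts \<open>n\<close> into the domain and then into the
    range, which adds two entries. Hence \<open>n\<close> stands at position \<open>2 * n\<close> of
    the left list and at \<open>2 * n + 1\<close> of the right list.\<close>
  define Q where "Q n pq \<longleftrightarrow> R (fst pq) (snd pq) \<and> length (fst pq) = 2 * n" for n :: nat and pq
  define step where "step n pq pq' \<longleftrightarrow> (\<exists>c d. fst pq' = fst pq @ [n, c] \<and> snd pq' = snd pq @ [d, n])"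
    for n :: nat and pq pq' :: "nat list \<times> nat list"
  have "\<exists>pq. Q 0 pq" using nil by (intro exI[of _ "([], [])"]) (simp add: Q_def)
  moreover have "\<exists>pq'. Q (Suc n) pq' \<and> step n pq pq'" if "Q n pq" for pq n
  proof -
    obtain p q where pq: "pq = (p, q)" by fastforce
    with that have R: "R p q" "length p = 2 * n" by (auto simp: Q_def)
    obtain d where "R (p @ [n]) (q @ [d])" using forth[OF R(1)] by blast
    then obtain c where "R ((p @ [n]) @ [c]) ((q @ [d]) @ [n])" using bwd by blast
    then show ?thesis using R(2)
      by (intro exI[of _ "(p @ [n, c], q @ [d, n])"]) (auto simp: Q_def step_def pq)
  qed
  ultimately obtain f where f: "\<And>n. Q n (f n)" "\<And>n. step n (f n) (f (Suc n))"
    using dependent_nat_choice[of Q step] by metis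
  define p where "p n = fst (f n)" for n
  define q where "q n = snd (f n)" for n
  have R: "R (p n) (q n)" and lp: "length (p n) = 2 * n" for n
    using f(1)[of n] by (auto simp: Q_def p_def q_def)
  have lq: "length (q n) = 2 * n" for n using len[OF R] lp by metis
  have S: "\<exists>c d. p (Suc n) = p n @ [n, c] \<and> q (Suc n) = q n @ [d, n]" for n
    using f(2)[of n] by (auto simp: step_def p_def q_def)
  define P where "P i = p (Suc i) ! i" for i
  define P' where "P' i = q (Suc i) ! i" for i
  have mono: "p (n + k) ! i = p n ! i \<and> q (n + k) ! i = q n ! i" if "i < 2 * n" for n k i
  proof (induction k)
    case (Suc k)
    obtain c d where "p (Suc (n + k)) = p (n + k) @ [n + k, c]" "q (Suc (n + k)) = q (n + k) @ [d, n + k]"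
      using S by blast
    then show ?case using Suc that by (simp add: nth_append lp lq)
  qed simp
  have P: "p n ! i = P i" "q n ! i = P' i" if "i < 2 * n" for n i
  proof -
    have "p n ! i = p (n + Suc i) ! i" "q n ! i = q (n + Suc i) ! i" using mono[of i n "Suc i"] that by auto
    moreover have "p (Suc i + n) ! i = p (Suc i) ! i" "q (Suc i + n) ! i = q (Suc i) ! i"
      using mono[of i "Suc i" n] by auto
    ultimately show "p n ! i = P i" "q n ! i = P' i" by (simp_all add: P_def P'_def add.commute)
  qed
  have surjP: "P (2 * n) = n" "P' (2 * n + 1) = n" for n
  proof -
    obtain c d where cd: "p (Suc n) = p n @ [n, c]" "q (Suc n) = q n @ [d, n]" using S by blast
    have "p (Suc n) ! (2 * n) = n" "q (Suc n) ! (2 * n + 1) = n"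
      by (simp_all add: cd nth_append lp lq)
    then show "P (2 * n) = n" "P' (2 * n + 1) = n"
      using P[of "2 * n" "Suc n"] P[of "2 * n + 1" "Suc n"] by auto
  qed
  have Peq: "P i = P j \<longleftrightarrow> P' i = P' j" for i j
  proof -
    have ij: "i < 2 * (Suc (i + j))" "j < 2 * (Suc (i + j))" by auto
    then show ?thesis using eq[OF R[of "Suc (i + j)"], of i j] P[OF ij(1)] P[OF ij(2)] by (simp add: lp)
  qed
  \<comment> \<open>Even positions enumerate the domain in order, odd ones the range, so the map and
    its inverse can be read off there.\<close>
  define \<pi> where "\<pi> n = P' (2 * n)" for n
  define \<rho> where "\<rho> n = P (2 * n + 1)" for n
  have \<pi>P: "\<pi> (P i) = P' i" for i using Peq[of "2 * P i" i] surjP by (simp add: \<pi>_def)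
  have "\<rho> (\<pi> n) = n" for n using Peq[of "2 * \<pi> n + 1" "2 * n"] surjP by (simp add: \<rho>_def \<pi>_def)
  moreover have "\<pi> (\<rho> n) = n" for n using \<pi>P[of "2 * n + 1"] surjP by (simp add: \<rho>_def)
  ultimately have "bij \<pi>" by (metis bijI')
  moreover have "M r xs \<longleftrightarrow> N r (map \<pi> xs)" if "length xs = ar r" for r xs
  proof -
    \<comment> \<open>The positions of the entries of \<open>xs\<close> in the left list. The sum of
      \<open>xs\<close> bounds every entry, so stage \<open>n\<close> contains them all.\<close>
    define js where "js = map (\<lambda>x. 2 * x) xs"
    define n where "n = Suc (sum_list xs)"
    have js: "i < 2 * n" if "i \<in> set js" for i
      using that member_le_sum_list[of _ xs] by (force simp: js_def n_def)
    have "p n ! (2 * x) = x" "q n ! (2 * x) = \<pi> x" if "x \<in> set xs" for x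
      using P[of "2 * x" n] js[of "2 * x"] surjP that by (auto simp: js_def \<pi>_def)
    then have "map ((!) (p n)) js = xs" "map ((!) (q n)) js = map \<pi> xs"
      by (auto simp: js_def intro: map_idI)
    moreover have "M r (map ((!) (p n)) js) \<longleftrightarrow> N r (map ((!) (q n)) js)"
      by (rule atomic[OF R]) (use js that in \<open>auto simp: lp js_def\<close>)
    ultimately show ?thesis by simp
  qed
  ultimately show ?thesis unfolding struct_iso_def by blast
qed

section \<open>Small moves of sequences\<close>

lemma open_box_fun:
  fixes z :: "nat \<Rightarrow> real"
  shows "open {x. \<forall>i<N. \<bar>x i - z i\<bar> < \<epsilon>}"
proof -
  have "open (\<Inter>i\<in>{..<N}. {x :: nat \<Rightarrow> real. \<bar>x i - z i\<bar> < \<epsilon>})"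
    by (intro open_INT ballI open_Collect_less continuous_intros finite_lessThan continuous_on_product_coordinates)
  also have "(\<Inter>i\<in>{..<N}. {x :: nat \<Rightarrow> real. \<bar>x i - z i\<bar> < \<epsilon>}) = {x. \<forall>i<N. \<bar>x i - z i\<bar> < \<epsilon>}" by auto
  finally show ?thesis .
qed

lemma finite_common_lower_bound:
  fixes \<rho> :: "nat \<Rightarrow> real"
  assumes "\<And>i. i < N \<Longrightarrow> \<rho> i > 0" obtains \<epsilon> where "\<epsilon> > 0" "\<And>i. i < N \<Longrightarrow> \<epsilon> \<le> \<rho> i"
proof (rule that)
  show "Min (insert 1 (\<rho> ` {..<N})) > 0" using assms by auto
  show "Min (insert 1 (\<rho> ` {..<N})) \<le> \<rho> i" if "i < N" for i using that by simp
qed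

text \<open>A basic open set of the product constrains finitely many coordinates, so one bound
  \<open>N\<close> and one radius serve for all of them.\<close>

lemma open_fun_contains_box:
  fixes z :: "nat \<Rightarrow> real"
  assumes "open S" "z \<in> S"
  obtains N \<epsilon> where "\<epsilon> > 0" "{x. \<forall>i<N. \<bar>x i - z i\<bar> < \<epsilon>} \<subseteq> S"
proof -
  have "openin (product_topology (\<lambda>i. euclidean) UNIV) S" using assms(1) by (simp add: open_fun_def)
  then obtain X where X: "z \<in> Pi\<^sub>E UNIV X" "\<And>i. open (X i)" "finite {i. X i \<noteq> UNIV}" "Pi\<^sub>E UNIV X \<subseteq> S"
    using product_topology_open_contains_basis[of "\<lambda>i. euclidean" UNIV S z] assms(2) by auto
  obtain N where N: "\<And>i. X i \<noteq> UNIV \<Longrightarrow> i < N"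
    using X(3) by (metis (mono_tags) finite_nat_set_iff_bounded mem_Collect_eq)
  have "\<exists>\<rho>>0. ball (z i) \<rho> \<subseteq> X i" for i
    using X(1,2) by (auto simp: open_contains_ball)
  then obtain \<rho> where \<rho>: "\<And>i. \<rho> i > 0" "\<And>i. ball (z i) (\<rho> i) \<subseteq> X i" by metis
  obtain \<epsilon> where \<epsilon>: "\<epsilon> > 0" "\<And>i. i < N \<Longrightarrow> \<epsilon> \<le> \<rho> i" using finite_common_lower_bound[of N \<rho>] \<rho>(1) by blast
  have "x \<in> S" if x: "\<forall>i<N. \<bar>x i - z i\<bar> < \<epsilon>" for x
  proof -
    have "x i \<in> X i" for i
    proof (cases "X i = UNIV")
      case False
      then have "i < N" by (rule N)
      then have "x i \<in> ball (z i) (\<rho> i)"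
        using x \<epsilon>(2)[of i] by (force simp: dist_real_def abs_minus_commute)
      then show ?thesis using \<rho>(2) by blast
    qed simp
    then show ?thesis using X(4) by (auto simp: PiE_UNIV_domain)
  qed
  then show ?thesis using that \<epsilon>(1) by blast
qed

text \<open>\<open>tanh\<close> admits arbitrary real sequences \<open>h\<close> as parameters, so
  these range over the same Polish space as \<open>x\<close>, while the factors make the
  displacements summable.\<close>

definition move :: "(nat \<Rightarrow> real) \<Rightarrow> (nat \<Rightarrow> real) \<Rightarrow> nat \<Rightarrow> real" where
  "move x h = (\<lambda>n. x n + (1/2) ^ (n + 2) * tanh (h n))"

definition unmove :: "(nat \<Rightarrow> real) \<Rightarrow> (nat \<Rightarrow> real) \<Rightarrow> nat \<Rightarrow> real" where
  "unmove y h = (\<lambda>n. y n - (1/2) ^ (n + 2) * tanh (h n))"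

lemma move_unmove [simp]: "move (unmove y h) h = y" "unmove (move x h) h = x"
  by (auto simp: move_def unmove_def)

lemma continuous_on_move:
  assumes "continuous_on S f" "continuous_on S g" shows "continuous_on S (\<lambda>z. move (f z) (g z))"
  unfolding move_def
  by (intro continuous_on_coordinatewise_then_product continuous_intros
      continuous_on_product_then_coordinatewise[OF assms(1)] continuous_on_product_then_coordinatewise[OF assms(2)]) simp

lemma continuous_on_unmove:
  assumes "continuous_on S f" "continuous_on S g" shows "continuous_on S (\<lambda>z. unmove (f z) (g z))"
  unfolding unmove_def
  by (intro continuous_on_coordinatewise_then_product continuous_intros
      continuous_on_product_then_coordinatewise[OF assms(1)] continuous_on_product_then_coordinatewise[OF assms(2)]) simp

text \<open>\<open>(x, h) \<mapsto> (move x h, h)\<close> is a homeomorphism with inverse given by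
  \<open>unmove\<close>, so it preserves genericity.\<close>

lemma eventually_generic_move:
  assumes "eventually P generic" shows "eventually (\<lambda>z. P (move (fst z) (snd z))) generic"
proof -
  have "eventually (\<lambda>z. P (fst (move (fst z) (snd z), snd z))) generic"
    by (rule eventually_generic_homeomorphism[OF eventually_generic_fst[OF assms],
        where \<phi> = "\<lambda>z. (move (fst z) (snd z), snd z)" and \<psi> = "\<lambda>z. (unmove (fst z) (snd z), snd z)"])
      (auto intro!: continuous_on_Pair continuous_on_move continuous_on_unmove continuous_on_fst continuous_on_snd)
  then show ?thesis by simp
qed

lemma eventually_generic_unmove_pair:
  assumes "eventually P generic" shows "eventually (\<lambda>z. P (unmove (fst z) (snd z), snd z)) generic"
  by (rule eventually_generic_homeomorphism[OF assms,
        where \<phi> = "\<lambda>z. (unmove (fst z) (snd z), snd z)" and \<psi> = "\<lambda>z. (move (fst z) (snd z), snd z)"])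
      (auto intro!: continuous_on_Pair continuous_on_move continuous_on_unmove continuous_on_fst continuous_on_snd)

text \<open>Chains of moves need a comeager set that generic moves do not leave. Each pass through
  Kuratowski-Ulam keeps the points from which generic moves stay in the previous set; the
  intersection of all passes is stable.\<close>

lemma eventually_generic_invariant_core:
  assumes P: "eventually P generic" and C0: "eventually (\<lambda>x. x \<in> C0) generic"
  obtains C where "eventually (\<lambda>x. x \<in> C) generic" "C \<subseteq> C0"
    "\<forall>y\<in>C. eventually (\<lambda>h. P (y, h) \<and> P (unmove y h, h) \<and> unmove y h \<in> C \<and> move y h \<in> C) generic"
proof -
  define Q where "Q = rec_nat C0 (\<lambda>k Q. {y \<in> Q. eventually (\<lambda>h. P (y, h) \<and> P (unmove y h, h) \<and> unmove y h \<in> Q \<and> move y h \<in> Q) generic})"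
  have Q0: "Q 0 = C0" and QS: "Q (Suc k) = {y \<in> Q k. eventually (\<lambda>h. P (y, h) \<and> P (unmove y h, h) \<and> unmove y h \<in> Q k \<and> move y h \<in> Q k) generic}" for k
    by (simp_all add: Q_def)
  have "eventually (\<lambda>x. x \<in> Q k) generic" for k
  proof (induction k)
    case (Suc k)
    have "eventually (\<lambda>z. P z \<and> P (unmove (fst z) (snd z), snd z) \<and> unmove (fst z) (snd z) \<in> Q k \<and> move (fst z) (snd z) \<in> Q k) generic"
      using eventually_generic_unmove_pair[OF eventually_generic_fst[OF Suc]]
      by (intro eventually_conj P eventually_generic_unmove_pair[OF P] eventually_generic_move[OF Suc]) simp
    from Kuratowski_Ulam[OF this] Suc show ?case
      unfolding QS by eventually_elim simp
  qed (simp add: Q0 C0)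
  then have gen: "eventually (\<lambda>x. \<forall>k. x \<in> Q k) generic" by (rule eventually_generic_countable_all)
  show ?thesis
  proof (rule that[of "\<Inter>k. Q k"])
    show "eventually (\<lambda>x. x \<in> (\<Inter>k. Q k)) generic" using gen by simp
    show "(\<Inter>k. Q k) \<subseteq> C0" using Q0 by blast
    show "\<forall>y\<in>\<Inter>k. Q k. eventually (\<lambda>h. P (y, h) \<and> P (unmove y h, h) \<and> unmove y h \<in> (\<Inter>k. Q k) \<and> move y h \<in> (\<Inter>k. Q k)) generic"
    proof
      fix y assume y: "y \<in> (\<Inter>k. Q k)"
      have "eventually (\<lambda>h. \<forall>k. P (y, h) \<and> P (unmove y h, h) \<and> unmove y h \<in> Q k \<and> move y h \<in> Q k) generic"
      proof (rule eventually_generic_countable_all)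
        fix k
        have "y \<in> Q (Suc k)" using y by blast
        then show "eventually (\<lambda>h. P (y, h) \<and> P (unmove y h, h) \<and> unmove y h \<in> Q k \<and> move y h \<in> Q k) generic"
          by (simp add: QS)
      qed
      then show "eventually (\<lambda>h. P (y, h) \<and> P (unmove y h, h) \<and> unmove y h \<in> (\<Inter>k. Q k) \<and> move y h \<in> (\<Inter>k. Q k)) generic"
        by eventually_elim auto
    qed
  qed
qed

section \<open>Approximation by chains of moves\<close>

lemma tanh_scaled_local_inverse:
  fixes a w \<epsilon> :: real
  assumes "w > 0" "\<epsilon> > 0"
  obtains \<eta> where "\<eta> > 0" "\<And>u. \<bar>u\<bar> < \<eta> \<Longrightarrow> \<exists>t. w * tanh t = w * tanh a + u \<and> \<bar>t - a\<bar> < \<epsilon>"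
proof -
  define l where "l = a - \<epsilon> / 2"
  define r where "r = a + \<epsilon> / 2"
  \<comment> \<open>The room left by the increasing function \<open>w * tanh\<close> on both sides
    of \<open>a\<close>; the intermediate value theorem does the rest.\<close>
  define \<eta> where "\<eta> = min (w * (tanh a - tanh l)) (w * (tanh r - tanh a))"
  have "\<eta> > 0" using assms by (simp add: \<eta>_def l_def r_def)
  moreover have "\<exists>t. w * tanh t = w * tanh a + u \<and> \<bar>t - a\<bar> < \<epsilon>" if "\<bar>u\<bar> < \<eta>" for u
  proof -
    have "w * tanh l \<le> w * tanh a + u" "w * tanh a + u \<le> w * tanh r"
      using that by (auto simp: \<eta>_def algebra_simps)
    moreover have "l \<le> r" using assms by (simp add: l_def r_def)
    moreover have "continuous_on {l..r} (\<lambda>t. w * tanh t)" by (intro continuous_intros) simp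
    ultimately obtain t where "l \<le> t" "t \<le> r" "w * tanh t = w * tanh a + u"
      using IVT'[of "\<lambda>t. w * tanh t" l "w * tanh a + u" r] by blast
    then show ?thesis using assms by (intro exI[of _ t]) (auto simp: l_def r_def)
  qed
  ultimately show ?thesis by (rule that)
qed

text \<open>One step \<open>move (unmove y h) h'\<close> reaches a neighbourhood of \<open>y\<close> whose size in the first \<open>M\<close>
  coordinates does not depend on \<open>y\<close>.\<close>
lemma generic_step:
  assumes C: "\<And>y. y \<in> C \<Longrightarrow> eventually (\<lambda>h. P (y, h) \<and> P (unmove y h, h) \<and> unmove y h \<in> C \<and> move y h \<in> C) generic"
    and E: "\<And>x h h'. (x, h) \<in> W \<Longrightarrow> (x, h') \<in> W \<Longrightarrow> P (x, h) \<Longrightarrow> P (x, h') \<Longrightarrow> E (move x h) (move x h')"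
    and W: "{(x, h). (\<forall>i<N. \<bar>x i - x0 i\<bar> < \<epsilon>) \<and> (\<forall>i<N. \<bar>h i - h0 i\<bar> < \<epsilon>)} \<subseteq> W"
    and "\<epsilon> > 0" "N \<le> M"
  shows "\<exists>\<eta>>0. \<forall>y\<in>C. \<forall>d. \<forall>\<rho>>0. (\<forall>i<N. \<bar>y i - move x0 h0 i\<bar> < \<epsilon>) \<longrightarrow> (\<forall>i<M. \<bar>d i\<bar> < \<eta>) \<longrightarrow>
       (\<forall>i<N. \<bar>y i + d i - move x0 h0 i\<bar> < \<epsilon>) \<longrightarrow>
       (\<exists>y'\<in>C. E y y' \<and> (\<forall>i<N. \<bar>y' i - move x0 h0 i\<bar> < \<epsilon>) \<and> (\<forall>i<M. \<bar>y' i - (y i + d i)\<bar> < \<rho>))"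
proof -
  define w :: "nat \<Rightarrow> real" where "w i = (1/2) ^ (i + 2)" for i
  \<comment> \<open>The parameter aimed at. It does not depend on \<open>y\<close>, which makes
    \<open>\<eta>\<close> uniform. Coordinates from \<open>N\<close> on are free and get the default
    0.\<close>
  define k where "k i = (if i < N then h0 i else 0)" for i
  have "\<exists>\<eta>>0. \<forall>u. \<bar>u\<bar> < \<eta> \<longrightarrow> (\<exists>t. w i * tanh t = w i * tanh (k i) + u \<and> \<bar>t - k i\<bar> < \<epsilon>)" for i
    by (rule tanh_scaled_local_inverse[of "w i" \<epsilon> "k i"]) (use \<open>\<epsilon> > 0\<close> in \<open>auto simp: w_def\<close>)
  then obtain \<eta>' where \<eta>': "\<And>i. \<eta>' i > 0"
    "\<And>i u. \<bar>u\<bar> < \<eta>' i \<Longrightarrow> \<exists>t. w i * tanh t = w i * tanh (k i) + u \<and> \<bar>t - k i\<bar> < \<epsilon>" by metis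
  obtain \<eta> where \<eta>: "\<eta> > 0" "\<And>i. i < M \<Longrightarrow> \<eta> \<le> \<eta>' i"
    using finite_common_lower_bound[of M \<eta>'] \<eta>'(1) by blast
  have "\<exists>y'\<in>C. E y y' \<and> (\<forall>i<N. \<bar>y' i - move x0 h0 i\<bar> < \<epsilon>) \<and> (\<forall>i<M. \<bar>y' i - (y i + d i)\<bar> < \<rho>)"
    if y: "y \<in> C" "\<forall>i<N. \<bar>y i - move x0 h0 i\<bar> < \<epsilon>" and d: "\<forall>i<M. \<bar>d i\<bar> < \<eta>"
      "\<forall>i<N. \<bar>y i + d i - move x0 h0 i\<bar> < \<epsilon>" and \<rho>: "\<rho> > 0" for y d \<rho>
  proof -
    \<comment> \<open>Replacing \<open>k\<close> by \<open>k'\<close> changes the endpoint by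
      exactly \<open>d\<close> in the first \<open>M\<close> coordinates.\<close>
    have "\<exists>t. w i * tanh t = w i * tanh (k i) + d i \<and> \<bar>t - k i\<bar> < \<epsilon>" if "i < M" for i
      using \<eta>'(2)[of "d i" i] \<eta>(2)[OF that] d(1) that by force
    then obtain k' where k': "\<And>i. i < M \<Longrightarrow> w i * tanh (k' i) = w i * tanh (k i) + d i \<and> \<bar>k' i - k i\<bar> < \<epsilon>"
      by metis
    define B where "B = {y'. \<forall>i<M. \<bar>y' i - (\<lambda>i. y i + d i) i\<bar> < \<rho>} \<inter> {y'. \<forall>i<N. \<bar>y' i - move x0 h0 i\<bar> < \<epsilon>}"
    have oB: "open B" unfolding B_def by (intro open_Int open_box_fun)
    \<comment> \<open>The pair \<open>k\<close>, \<open>k'\<close> need not be generic. The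
      conditions on it are open, so first \<open>k\<close> is perturbed to a generic
      \<open>h\<close>, and then, with \<open>x\<close> fixed, \<open>k'\<close> to a generic
      \<open>h'\<close>.\<close>
    define H1 where "H1 = {h. \<forall>i<N. \<bar>h i - h0 i\<bar> < \<epsilon>} \<inter> (\<lambda>h. unmove y h) -` {x. \<forall>i<N. \<bar>x i - x0 i\<bar> < \<epsilon>}
      \<inter> (\<lambda>h. move (unmove y h) k') -` B"
    have "open H1" unfolding H1_def
      by (intro open_Int open_box_fun open_vimage oB continuous_on_move continuous_on_unmove
          continuous_on_const continuous_on_id)
    moreover have "k \<in> H1"
    proof -
      have "move (unmove y k) k' i = y i + d i" if "i < M" for i
      proof -
        have "move (unmove y k) k' i = y i - w i * tanh (k i) + w i * tanh (k' i)"
          by (simp add: move_def unmove_def w_def)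
        then show ?thesis using k'[OF that] by simp
      qed
      \<comment> \<open>As \<open>k\<close> agrees with \<open>h0\<close> here,
        \<open>unmove y k\<close> is as close to \<open>x0\<close> as \<open>y\<close> is to
        \<open>move x0 h0\<close>.\<close>
      moreover have "unmove y k i - x0 i = y i - move x0 h0 i" if "i < N" for i
        using that by (simp add: move_def unmove_def k_def)
      ultimately show ?thesis
        using y(2) d(2) \<rho> \<open>\<epsilon> > 0\<close> \<open>N \<le> M\<close> by (auto simp: H1_def B_def k_def)
    qed
    ultimately obtain h where h: "h \<in> H1" "P (unmove y h, h)" "unmove y h \<in> C"
      using generic_exists_in_open[OF C[OF y(1)], of H1] by blast
    define x where "x = unmove y h"
    have x: "x \<in> C" "P (x, h)" "move x h = y" using h by (auto simp: x_def)
    define H2 where "H2 = {h. \<forall>i<N. \<bar>h i - h0 i\<bar> < \<epsilon>} \<inter> (\<lambda>h. move x h) -` B"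
    have "open H2" unfolding H2_def
      by (intro open_Int open_box_fun open_vimage oB continuous_on_move continuous_on_const continuous_on_id)
    moreover have "k' \<in> H2"
    proof -
      have "\<bar>k' i - h0 i\<bar> < \<epsilon>" if "i < N" for i
        using k'[of i] that \<open>N \<le> M\<close> by (simp add: k_def)
      then show ?thesis using h(1) by (auto simp: H1_def H2_def x_def)
    qed
    ultimately obtain h' where h': "h' \<in> H2" "P (x, h')" "move x h' \<in> C"
      using generic_exists_in_open[OF C[OF x(1)], of H2] by blast
    have "(x, h) \<in> W" "(x, h') \<in> W" using h(1) h'(1) W by (auto simp: H1_def H2_def x_def)
    then have "E y (move x h')" using E x h' by metis
    moreover have "move x h' \<in> B" using h'(1) by (simp add: H2_def)
    ultimately show ?thesis using h'(3) by (intro bexI[of _ "move x h'"]) (auto simp: B_def)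
  qed
  with \<eta>(1) show ?thesis by (intro exI[of _ \<eta>] conjI ballI allI impI) auto
qed

lemma abs_convex_combination_less:
  fixes a b c t e :: real
  assumes "\<bar>a - c\<bar> < e" "\<bar>b - c\<bar> < e" "0 \<le> t" "t \<le> 1"
  shows "\<bar>a + t * (b - a) - c\<bar> < e"
proof -
  have "convex {c - e<..<c + e}" by (rule convex_real_interval)
  moreover have "a \<in> {c - e<..<c + e}" "b \<in> {c - e<..<c + e}" using assms by auto
  ultimately have "(1 - t) *\<^sub>R a + t *\<^sub>R b \<in> {c - e<..<c + e}"
    using assms by (intro convexD_alt) auto
  then show ?thesis by (auto simp: algebra_simps abs_less_iff)
qed

text \<open>Follow the segment from \<open>y\<close> to \<open>z\<close> in \<open>m\<close> short
  steps. The box is convex, so the points of the segment may serve as targets; errors do not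
  accumulate, since each step aims at the segment itself and can be as exact as desired.\<close>

lemma generic_reach:
  assumes C: "\<And>y. y \<in> C \<Longrightarrow> eventually (\<lambda>h. P (y, h) \<and> P (unmove y h, h) \<and> unmove y h \<in> C \<and> move y h \<in> C) generic"
    and E: "\<And>x h h'. (x, h) \<in> W \<Longrightarrow> (x, h') \<in> W \<Longrightarrow> P (x, h) \<Longrightarrow> P (x, h') \<Longrightarrow> E (move x h) (move x h')"
    and refl: "\<And>y. E y y" and trans: "\<And>x y z. E x y \<Longrightarrow> E y z \<Longrightarrow> E x z"
    and W: "{(x, h). (\<forall>i<N. \<bar>x i - x0 i\<bar> < \<epsilon>) \<and> (\<forall>i<N. \<bar>h i - h0 i\<bar> < \<epsilon>)} \<subseteq> W"
    and "\<epsilon> > 0"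
    and y: "y \<in> C" "\<forall>i<N. \<bar>y i - move x0 h0 i\<bar> < \<epsilon>"
    and S: "open S" "z \<in> S" "\<forall>i<N. \<bar>z i - move x0 h0 i\<bar> < \<epsilon>"
  shows "\<exists>y'\<in>C. y' \<in> S \<and> E y y' \<and> (\<forall>i<N. \<bar>y' i - move x0 h0 i\<bar> < \<epsilon>)"
proof -
  obtain M' \<rho>0 where M': "\<rho>0 > 0" "{x. \<forall>i<M'. \<bar>x i - z i\<bar> < \<rho>0} \<subseteq> S"
    by (rule open_fun_contains_box[OF S(1,2)])
  define M where "M = max N M'"
  have "N \<le> M" by (simp add: M_def)
  define U where "U y \<longleftrightarrow> (\<forall>i<N. \<bar>y i - move x0 h0 i\<bar> < \<epsilon>)" for y
  have "\<exists>\<eta>>0. \<forall>y\<in>C. \<forall>d. \<forall>\<rho>>0. U y \<longrightarrow> (\<forall>i<M. \<bar>d i\<bar> < \<eta>) \<longrightarrow>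
       (\<forall>i<N. \<bar>y i + d i - move x0 h0 i\<bar> < \<epsilon>) \<longrightarrow>
       (\<exists>y'\<in>C. E y y' \<and> U y' \<and> (\<forall>i<M. \<bar>y' i - (y i + d i)\<bar> < \<rho>))"
    unfolding U_def by (rule generic_step[where P = P and W = W]) (fact C E W \<open>\<epsilon> > 0\<close> \<open>N \<le> M\<close>)+
  then obtain \<eta> where \<eta>: "\<eta> > 0"
    "\<forall>y\<in>C. \<forall>d. \<forall>\<rho>>0. U y \<longrightarrow> (\<forall>i<M. \<bar>d i\<bar> < \<eta>) \<longrightarrow>
       (\<forall>i<N. \<bar>y i + d i - move x0 h0 i\<bar> < \<epsilon>) \<longrightarrow>
       (\<exists>y'\<in>C. E y y' \<and> U y' \<and> (\<forall>i<M. \<bar>y' i - (y i + d i)\<bar> < \<rho>))"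
    by (elim exE conjE)
  \<comment> \<open>The number of steps: one \<open>m\<close>-th of the segment is shorter than
    \<open>\<eta> / 2\<close> in each controlled coordinate.\<close>
  obtain m :: nat where m: "m > 0" "\<And>i. i < M \<Longrightarrow> \<bar>z i - y i\<bar> / m < \<eta> / 2"
  proof -
    define s where "s = (\<Sum>i<M. \<bar>z i - y i\<bar>)"
    obtain m :: nat where m: "2 * s / \<eta> < m" using reals_Archimedean2 by blast
    have s0: "0 \<le> s" by (simp add: s_def sum_nonneg)
    have "0 \<le> 2 * s / \<eta>" using s0 \<eta>(1) by simp
    then have "m > 0" using m by (cases "m = 0") auto
    moreover have "\<bar>z i - y i\<bar> / m < \<eta> / 2" if "i < M" for i
    proof -
      have "\<bar>z i - y i\<bar> \<le> s" unfolding s_def using that by (intro member_le_sum) auto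
      moreover have "s / m < \<eta> / 2" using m \<eta>(1) \<open>m > 0\<close> by (simp add: field_simps)
      ultimately show ?thesis by (meson divide_right_mono le_less_trans of_nat_0_le_iff)
    qed
    ultimately show ?thesis by (rule that)
  qed
  have "\<exists>y'\<in>C. E y y' \<and> U y' \<and> (\<forall>i<M. \<bar>y' i - (y i + (k / m) * (z i - y i))\<bar> < \<rho>)"
    if "k \<le> m" "\<rho> > 0" for k \<rho>
    using that
  proof (induction k arbitrary: \<rho>)
    case 0
    then show ?case using y refl by (intro bexI[of _ y]) (auto simp: U_def)
  next
    case (Suc k)
    then obtain y' where y': "y' \<in> C" "E y y'" "U y'"
      "\<forall>i<M. \<bar>y' i - (y i + (k / m) * (z i - y i))\<bar> < \<eta> / 2"
      using Suc.IH[of "\<eta> / 2"] \<eta>(1) by auto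
    \<comment> \<open>The displacement to the next target corrects the old error, which is below
      \<open>\<eta> / 2\<close>, and advances by less than \<open>\<eta> / 2\<close>.\<close>
    define d where "d i = y i + (Suc k / m) * (z i - y i) - y' i" for i
    have "\<bar>d i\<bar> < \<eta>" if "i < M" for i
    proof -
      define u where "u = y i + (k / m) * (z i - y i) - y' i"
      define v where "v = (z i - y i) / m"
      have "d i = u + v" using m(1) by (simp add: d_def u_def v_def field_simps)
      moreover have "\<bar>v\<bar> < \<eta> / 2" using m(2)[OF that] by (simp add: v_def)
      moreover have "\<bar>u\<bar> < \<eta> / 2" using y'(4) that by (simp add: u_def abs_minus_commute)
      ultimately show ?thesis by arith
    qed
    moreover have "\<bar>y' i + d i - move x0 h0 i\<bar> < \<epsilon>" if "i < N" for i
    proof -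
      have "Suc k / m \<le> 1" using Suc.prems(1) m(1) by simp
      then have "\<bar>y i + (Suc k / m) * (z i - y i) - move x0 h0 i\<bar> < \<epsilon>"
        using y(2) S(3) that by (intro abs_convex_combination_less) auto
      then show ?thesis by (simp add: d_def)
    qed
    ultimately obtain y'' where y'': "y'' \<in> C" "E y' y''" "U y''" "\<forall>i<M. \<bar>y'' i - (y' i + d i)\<bar> < \<rho>"
      using \<eta>(2)[rule_format, of y' \<rho> d] y' Suc.prems(2) by blast
    moreover have "y' i + d i = y i + (Suc k / m) * (z i - y i)" for i by (simp add: d_def)
    ultimately show ?case using trans[OF y'(2) y''(2)] by auto
  qed
  from this[of m \<rho>0] obtain y' where y': "y' \<in> C" "E y y'" "U y'" "\<forall>i<M. \<bar>y' i - z i\<bar> < \<rho>0"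
    using m(1) M'(1) by auto
  then have "y' \<in> S" using M'(2) by (auto simp: M_def)
  with y' show ?thesis by (auto simp: U_def)
qed

section \<open>Generic ergodicity of the moves\<close>

locale generic_homomorphism =
  fixes ar :: "'l::countable \<Rightarrow> nat" and g :: "(nat \<Rightarrow> real) \<Rightarrow> 'l \<Rightarrow> nat list \<Rightarrow> bool"
  assumes borel: "\<And>r xs. {x. g x r xs} \<in> sets borel"
    and hom: "\<And>x h. struct_iso ar (g x) (g (move x h))"
begin

definition linked :: "nat list \<Rightarrow> nat list \<Rightarrow> (nat \<Rightarrow> real) \<times> (nat \<Rightarrow> real) \<Rightarrow> bool" where
  "linked a b z \<longleftrightarrow> tuple_iso ar (g (fst z)) a (g (move (fst z) (snd z))) b"

text \<open>The tuple \<open>a\<close> is the same all over \<open>W\<close>. Two links with a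
  common first coordinate can therefore be composed, which carries \<open>b\<close> at
  \<open>move x h\<close> to \<open>b\<close> at \<open>move x h'\<close>.\<close>

definition chart :: "nat list \<Rightarrow> ((nat \<Rightarrow> real) \<times> (nat \<Rightarrow> real)) set \<Rightarrow> nat list \<Rightarrow> bool" where
  "chart b W a \<longleftrightarrow> open W \<and> eventually (\<lambda>z. z \<in> W \<longrightarrow> linked a b z) generic"

text \<open>Continuity of \<open>g\<close> restricted to \<open>C\<close>, atomic fact by atomic
  fact.\<close>

definition locally_constant_on :: "(nat \<Rightarrow> real) set \<Rightarrow> bool" where
  "locally_constant_on C \<longleftrightarrow>
     (\<forall>x\<in>C. \<forall>r xs. \<exists>U. open U \<and> x \<in> U \<and> (\<forall>y\<in>U \<inter> C. g y r xs \<longleftrightarrow> g x r xs))"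

lemma ex_generic_locally_constant:
  obtains C where "eventually (\<lambda>x. x \<in> C) generic" "locally_constant_on C"
proof -
  obtain C where C: "eventually (\<lambda>x. x \<in> C) generic"
    "\<And>x i. x \<in> C \<Longrightarrow> \<exists>U. open U \<and> x \<in> U \<and> (\<forall>y\<in>U \<inter> C. y \<in> {x. g x (fst i) (snd i)} \<longleftrightarrow> x \<in> {x. g x (fst i) (snd i)})"
    by (rule borel_generically_locally_constant[where A = "\<lambda>i. {x. g x (fst i) (snd i)}"]) (use borel in blast)+
  have "locally_constant_on C" unfolding locally_constant_on_def using C(2)[of _ "(_, _)"] by simp
  with C(1) show ?thesis by (rule that)
qed

text \<open>Values of \<open>\<pi>\<close> and of its inverse alternate. Recording both makes a
  limit of such codes a bijection; the values of \<open>\<pi>\<close> alone would only secure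
  injectivity.\<close>

definition codes :: "nat list \<Rightarrow> (nat \<Rightarrow> nat) \<Rightarrow> bool" where
  "codes s \<pi> \<longleftrightarrow> (\<forall>i<length s. s ! i = (if even i then \<pi> (i div 2) else inv \<pi> (i div 2)))"

text \<open>Arbitrarily close to \<open>z\<close> there are isomorphisms that agree with the limit
  map \<open>p\<close> on long initial segments. An atomic fact involves finitely many values of
  \<open>p\<close> and is locally constant on \<open>C\<close>, so it passes to \<open>z\<close>.
  This is why the closures in \<open>generic_branch\<close> suffice.\<close>

lemma branch_imp_linked:
  assumes C: "locally_constant_on C" and z: "fst z \<in> C" "move (fst z) (snd z) \<in> C"
    and br: "\<And>n. z \<in> closure {z. fst z \<in> C \<and> move (fst z) (snd z) \<in> C \<and>
      (\<exists>\<pi>. iso_via ar (g (fst z)) (g (move (fst z) (snd z))) \<pi> \<and> map \<pi> a = b \<and> codes (map \<nu> [0..<n]) \<pi>)}"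
  shows "linked a b z"
proof -
  define p where "p k = \<nu> (2 * k)" for k
  define q where "q k = \<nu> (2 * k + 1)" for k
  have near: "\<exists>z' \<pi>. z' \<in> U \<and> fst z' \<in> C \<and> move (fst z') (snd z') \<in> C \<and>
      iso_via ar (g (fst z')) (g (move (fst z') (snd z'))) \<pi> \<and> map \<pi> a = b \<and>
      (\<forall>k\<le>n. \<pi> k = p k \<and> inv \<pi> k = q k)" if U: "open U" "z \<in> U" for U n
  proof -
    \<comment> \<open>\<open>2 * n + 2\<close> entries record \<open>\<pi>\<close> and its inverse
      at the arguments from 0 to \<open>n\<close>.\<close>
    let ?A = "{z. fst z \<in> C \<and> move (fst z) (snd z) \<in> C \<and>
      (\<exists>\<pi>. iso_via ar (g (fst z)) (g (move (fst z) (snd z))) \<pi> \<and> map \<pi> a = b \<and> codes (map \<nu> [0..<2 * n + 2]) \<pi>)}"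
    have "U \<inter> ?A \<noteq> {}" using br[of "2 * n + 2"] U open_Int_closure_eq_empty[OF U(1), of ?A] by blast
    then obtain z' \<pi> where z': "z' \<in> U" "fst z' \<in> C" "move (fst z') (snd z') \<in> C"
      "iso_via ar (g (fst z')) (g (move (fst z') (snd z'))) \<pi>" "map \<pi> a = b"
      and cod: "codes (map \<nu> [0..<2 * n + 2]) \<pi>" by blast
    have "\<nu> i = (if even i then \<pi> (i div 2) else inv \<pi> (i div 2))" if "i < 2 * n + 2" for i
      using cod that unfolding codes_def by (auto simp del: upt_Suc)
    from this[of "2 * _"] this[of "2 * _ + 1"] have "\<forall>k\<le>n. \<pi> k = p k \<and> inv \<pi> k = q k"
      by (auto simp: p_def q_def)
    with z' show ?thesis by blast
  qed
  \<comment> \<open>A single \<open>\<pi>\<close> that agrees with \<open>p\<close> and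
    \<open>q\<close> at \<open>k\<close>, \<open>p k\<close> and \<open>q k\<close> shows both
    identities.\<close>
  have inv: "q (p k) = k \<and> p (q k) = k" for k
  proof -
    obtain z' \<pi> where "iso_via ar (g (fst z')) (g (move (fst z') (snd z'))) \<pi>"
      and \<pi>: "\<forall>k'\<le>k + p k + q k. \<pi> k' = p k' \<and> inv \<pi> k' = q k'" using near[of UNIV "k + p k + q k"] by auto
    then have "bij \<pi>" by (simp add: iso_via_def)
    then have "inv \<pi> (\<pi> k) = k" "\<pi> (inv \<pi> k) = k" by (simp_all add: bij_is_inj bij_is_surj surj_f_inv_f)
    then show ?thesis using \<pi> by simp
  qed
  have "iso_via ar (g (fst z)) (g (move (fst z) (snd z))) p"
    unfolding iso_via_def
  proof (intro conjI allI impI)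
    show "bij p" using inv by (metis bijI')
    fix r and xs :: "nat list" assume len: "length xs = ar r"
    obtain U1 where U1: "open U1" "fst z \<in> U1" "\<forall>y\<in>U1 \<inter> C. g y r xs \<longleftrightarrow> g (fst z) r xs"
      using C z unfolding locally_constant_on_def by meson
    obtain U2 where U2: "open U2" "move (fst z) (snd z) \<in> U2"
      "\<forall>y\<in>U2 \<inter> C. g y r (map p xs) \<longleftrightarrow> g (move (fst z) (snd z)) r (map p xs)"
      using C z unfolding locally_constant_on_def by meson
    define U where "U = fst -` U1 \<inter> (\<lambda>z. move (fst z) (snd z)) -` U2"
    have "open U" unfolding U_def
      by (intro open_Int open_vimage U1 U2 continuous_on_move continuous_on_fst continuous_on_snd continuous_on_id)
    moreover have "z \<in> U" using U1 U2 by (simp add: U_def)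
    ultimately obtain z' \<pi> where z': "z' \<in> U" "fst z' \<in> C" "move (fst z') (snd z') \<in> C"
      "iso_via ar (g (fst z')) (g (move (fst z') (snd z'))) \<pi>"
      and \<pi>: "\<forall>k\<le>sum_list xs. \<pi> k = p k \<and> inv \<pi> k = q k" using near[of U "sum_list xs"] by blast
    have "map \<pi> xs = map p xs" using \<pi> member_le_sum_list[of _ xs] by auto
    then have "g (fst z') r xs \<longleftrightarrow> g (move (fst z') (snd z')) r (map p xs)"
      using z'(4) len unfolding iso_via_def by metis
    then show "g (fst z) r xs \<longleftrightarrow> g (move (fst z) (snd z)) r (map p xs)"
      using U1(3) U2(3) z'(1-3) by (auto simp: U_def)
  qed
  moreover have "map p a = b"
  proof -
    obtain \<pi> where "map \<pi> a = b" "\<forall>k\<le>sum_list a. \<pi> k = p k" using near[of UNIV "sum_list a"] by auto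
    moreover from this have "map \<pi> a = map p a" using member_le_sum_list[of _ a] by auto
    ultimately show ?thesis by simp
  qed
  ultimately show ?thesis unfolding linked_def tuple_iso_def by blast
qed

text \<open>At a generic point of \<open>S\<close> some tuple is linked to \<open>b\<close>. There
  are countably many tuples, so one of them is linked on a nonmeager set. The codes of the
  isomorphisms form a Suslin scheme for this set, and \<open>generic_branch\<close> makes the link
  generic in an open set.\<close>

lemma ex_chart:
  assumes S: "open S" "S \<noteq> {}"
  obtains W a where "chart b W a" "W \<noteq> {}" "W \<subseteq> S"
proof -
  obtain C where gC: "eventually (\<lambda>x. x \<in> C) generic" and C: "locally_constant_on C"
    by (rule ex_generic_locally_constant)
  define A where "A a s = {z. fst z \<in> C \<and> move (fst z) (snd z) \<in> C \<and>
      (\<exists>\<pi>. iso_via ar (g (fst z)) (g (move (fst z) (snd z))) \<pi> \<and> map \<pi> a = b \<and> codes s \<pi>)}" for a s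
  have gen: "eventually (\<lambda>z. fst z \<in> C \<and> move (fst z) (snd z) \<in> C) generic"
    by (intro eventually_conj eventually_generic_fst eventually_generic_move gC)
  have "\<exists>a. \<not> meager (A a [] \<inter> S)"
  proof (rule ccontr)
    assume "\<nexists>a. \<not> meager (A a [] \<inter> S)"
    then have "eventually (\<lambda>z. z \<notin> A a [] \<inter> S) generic" for a
      unfolding eventually_generic not_not Collect_mem_eq by blast
    then have "eventually (\<lambda>z. \<forall>a. z \<notin> A a [] \<inter> S) generic" by (rule eventually_generic_countable_all)
    with gen have "eventually (\<lambda>z. (\<forall>a. z \<notin> A a [] \<inter> S) \<and> fst z \<in> C \<and> move (fst z) (snd z) \<in> C) generic"
      by eventually_elim blast
    then obtain z where z: "z \<in> S" "\<And>a. z \<notin> A a [] \<inter> S" "fst z \<in> C" "move (fst z) (snd z) \<in> C"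
      using generic_exists_in_open[OF _ S] by blast
    obtain a where "tuple_iso ar (g (fst z)) a (g (move (fst z) (snd z))) b"
      using hom struct_iso_imp_tuple_iso by metis
    then have "z \<in> A a []" using z by (auto simp: A_def tuple_iso_def codes_def)
    then show False using z by blast
  qed
  then obtain a where a: "\<not> meager (A a [] \<inter> S)" by blast
  have "A a s \<subseteq> (\<Union>k. A a (s @ [k]))" for s
  proof
    fix z assume "z \<in> A a s"
    then obtain \<pi> where z: "fst z \<in> C" "move (fst z) (snd z) \<in> C"
      and \<pi>: "iso_via ar (g (fst z)) (g (move (fst z) (snd z))) \<pi>" "map \<pi> a = b" "codes s \<pi>"
      unfolding A_def by blast
    have "codes (s @ [if even (length s) then \<pi> (length s div 2) else inv \<pi> (length s div 2)]) \<pi>"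
      using \<pi>(3) by (auto simp: codes_def nth_append less_Suc_eq)
    then show "z \<in> (\<Union>k. A a (s @ [k]))" using z \<pi> unfolding A_def by blast
  qed
  then obtain W where W: "open W" "W \<noteq> {}" "W \<subseteq> S"
    "eventually (\<lambda>z. z \<in> W \<longrightarrow> (\<exists>\<nu>. \<forall>n. z \<in> closure (A a (map \<nu> [0..<n])))) generic"
    using generic_branch[of "A a" S] S(1) a by blast
  have "eventually (\<lambda>z. z \<in> W \<longrightarrow> linked a b z) generic"
    using W(4) gen
  proof eventually_elim
    case (elim z)
    show ?case
    proof
      assume "z \<in> W"
      then obtain \<nu> where "\<And>n. z \<in> closure (A a (map \<nu> [0..<n]))" using elim by blast
      then show "linked a b z" using elim unfolding A_def by (intro branch_imp_linked[OF C]) auto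
    qed
  qed
  then show ?thesis using that W by (auto simp: chart_def)
qed

theorem generically_isomorphic:
  "\<exists>C. eventually (\<lambda>x. x \<in> C) generic \<and> (\<forall>x\<in>C. \<forall>y\<in>C. struct_iso ar (g x) (g y))"
proof -
  obtain B0 :: "((nat \<Rightarrow> real) \<times> (nat \<Rightarrow> real)) set set" where B0: "countable B0" "topological_basis B0"
    using ex_countable_basis by blast
  \<comment> \<open>\<open>UNIV\<close> joins the basis so that the trivial chart of the empty tuple
    is available.\<close>
  define B where "B = insert UNIV B0"
  have cB: "countable B" using B0 by (simp add: B_def)
  have oB: "open W" if "W \<in> B" for W using that B0 topological_basis_open by (auto simp: B_def)
  \<comment> \<open>Every tuple has a chart around \<open>z\<close>, and all charts from
    \<open>B\<close> around \<open>z\<close> are truthful at \<open>z\<close>.\<close>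
  define P where "P z \<longleftrightarrow> (\<forall>b. \<exists>a. \<exists>W\<in>B. chart b W a \<and> z \<in> W) \<and>
    (\<forall>W\<in>B. \<forall>a b. chart b W a \<longrightarrow> z \<in> W \<longrightarrow> linked a b z)" for z
  have "eventually (\<lambda>z. \<exists>a. \<exists>W\<in>B. chart b W a \<and> z \<in> W) generic" for b
  proof -
    let ?U = "\<Union>{W\<in>B. \<exists>a. chart b W a}"
    have "eventually (\<lambda>z. z \<in> ?U) generic"
    proof (rule eventually_generic_dense_open)
      show "open ?U" using oB by blast
      show "closure ?U = UNIV" unfolding closure_UNIV_iff
      proof (intro allI impI)
        fix S :: "((nat \<Rightarrow> real) \<times> (nat \<Rightarrow> real)) set" assume "open S" "S \<noteq> {}"
        then obtain W a where W: "chart b W a" "W \<noteq> {}" "W \<subseteq> S" by (rule ex_chart)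
        then obtain z where z: "z \<in> W" by blast
        have "open W" using W(1) by (simp add: chart_def)
        then obtain V where V: "V \<in> B0" "z \<in> V" "V \<subseteq> W"
          by (rule topological_basisE[OF B0(2) _ z])
        have "eventually (\<lambda>z. z \<in> V \<longrightarrow> linked a b z) generic"
          using W(1) V(3) by (auto simp: chart_def elim!: eventually_mono)
        then have "chart b V a" using oB[of V] V by (simp add: chart_def B_def)
        then have "V \<in> {W\<in>B. \<exists>a. chart b W a}" using V(1) by (auto simp: B_def)
        then have "z \<in> S \<inter> ?U" using V(2,3) W(3) by blast
        then show "S \<inter> ?U \<noteq> {}" by blast
      qed
    qed
    then show ?thesis by eventually_elim blast
  qed
  moreover have "eventually (\<lambda>z. \<forall>W\<in>B. \<forall>a b. chart b W a \<longrightarrow> z \<in> W \<longrightarrow> linked a b z) generic"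
  proof (intro eventually_generic_countable_ball cB eventually_generic_countable_all)
    show "eventually (\<lambda>z. chart b W a \<longrightarrow> z \<in> W \<longrightarrow> linked a b z) generic" for W a b
      by (cases "chart b W a") (auto simp: chart_def)
  qed
  ultimately have gP: "eventually P generic"
    unfolding P_def by (intro eventually_conj eventually_generic_countable_all)
  obtain C0 where gC0: "eventually (\<lambda>x. x \<in> C0) generic" and C0: "locally_constant_on C0"
    by (rule ex_generic_locally_constant)
  obtain C where gC: "eventually (\<lambda>x. x \<in> C) generic" and "C \<subseteq> C0"
    and C': "\<forall>y\<in>C. eventually (\<lambda>h. P (y, h) \<and> P (unmove y h, h) \<and> unmove y h \<in> C \<and> move y h \<in> C) generic"
    by (rule eventually_generic_invariant_core[OF gP gC0])
  note C = C'[rule_format]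

  define V where "V N \<epsilon> y0 = {y::nat \<Rightarrow> real. \<forall>i<N. \<bar>y i - y0 i\<bar> < \<epsilon>}" for N and \<epsilon> :: real and y0
  have oV: "open (V N \<epsilon> y0)" for N \<epsilon> y0 unfolding V_def by (rule open_box_fun)
  define E where "E b y y' \<longleftrightarrow> tuple_iso ar (g y) b (g y') b" for b y y'
  \<comment> \<open>The form of turbulence used here: from each point of \<open>C\<close> in
    \<open>U\<close>, the points of \<open>C\<close> at which \<open>b\<close> has the same type are
    dense in \<open>U\<close>.\<close>
  define good where "good b U \<longleftrightarrow> open U \<and> (\<forall>y\<in>C \<inter> U. \<forall>S. open S \<longrightarrow> S \<inter> U \<noteq> {} \<longrightarrow> (\<exists>y'\<in>C \<inter> U \<inter> S. E b y y'))" for b U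
  have good_box: "good b (V N \<epsilon> (move x0 h0))"
    if "W \<in> B" "chart b W a" "\<epsilon> > 0" "{(x, h). (\<forall>i<N. \<bar>x i - x0 i\<bar> < \<epsilon>) \<and> (\<forall>i<N. \<bar>h i - h0 i\<bar> < \<epsilon>)} \<subseteq> W"
    for b W a N \<epsilon> x0 h0
    unfolding good_def
  proof (intro conjI oV ballI allI impI)
    fix y S assume y: "y \<in> C \<inter> V N \<epsilon> (move x0 h0)" and "open S" "S \<inter> V N \<epsilon> (move x0 h0) \<noteq> {}"
    then obtain z where z: "z \<in> S" "\<forall>i<N. \<bar>z i - move x0 h0 i\<bar> < \<epsilon>" by (auto simp: V_def)
    have "\<exists>y'\<in>C. y' \<in> S \<and> E b y y' \<and> (\<forall>i<N. \<bar>y' i - move x0 h0 i\<bar> < \<epsilon>)"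
    proof (rule generic_reach[where P = P and W = W and z = z])
      show "eventually (\<lambda>h. P (y, h) \<and> P (unmove y h, h) \<and> unmove y h \<in> C \<and> move y h \<in> C) generic"
        if "y \<in> C" for y by (rule C[OF that])
      show "E b (move x h) (move x h')" if "(x, h) \<in> W" "(x, h') \<in> W" "P (x, h)" "P (x, h')" for x h h'
      proof -
        have "linked a b (x, h)" "linked a b (x, h')"
          using that \<open>W \<in> B\<close> \<open>chart b W a\<close> unfolding P_def by blast+
        then show ?thesis unfolding linked_def E_def fst_conv snd_conv
          by (rule tuple_iso_trans[OF tuple_iso_sym])
      qed
      show "E b y y" for y unfolding E_def by (rule tuple_iso_refl)
      show "E b x z" if "E b x y" "E b y z" for x y z
        using that unfolding E_def by (rule tuple_iso_trans)
      show "y \<in> C" "\<forall>i<N. \<bar>y i - move x0 h0 i\<bar> < \<epsilon>" using y by (auto simp: V_def)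
    qed fact+
    then show "\<exists>y'\<in>C \<inter> V N \<epsilon> (move x0 h0) \<inter> S. E b y y'" by (auto simp: V_def)
  qed
  \<comment> \<open>Every \<open>y\<close> in \<open>C\<close> is the end of a generic move that
    starts at \<open>unmove y h\<close>. A box inside a chart around this move yields a good box
    centred at \<open>y\<close>.\<close>
  have good_ex: "\<exists>U. good b U \<and> y \<in> U" if y: "y \<in> C" for b y
  proof -
    obtain h where h: "P (unmove y h, h)"
      using generic_exists_in_open[OF C[OF y], of UNIV] by auto
    then obtain a W where W: "W \<in> B" "chart b W a" "(unmove y h, h) \<in> W" unfolding P_def by blast
    obtain W1 W2 where W12': "open W1" "open W2" "(unmove y h, h) \<in> W1 \<times> W2" "W1 \<times> W2 \<subseteq> W"
      by (rule open_prod_elim[OF oB[OF W(1)] W(3)])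
    then have W12: "open W1" "open W2" "unmove y h \<in> W1" "h \<in> W2" "W1 \<times> W2 \<subseteq> W" by auto
    obtain N1 \<epsilon>1 where 1: "\<epsilon>1 > 0" "{x. \<forall>i<N1. \<bar>x i - unmove y h i\<bar> < \<epsilon>1} \<subseteq> W1"
      by (rule open_fun_contains_box[OF W12(1,3)])
    obtain N2 \<epsilon>2 where 2: "\<epsilon>2 > 0" "{x. \<forall>i<N2. \<bar>x i - h i\<bar> < \<epsilon>2} \<subseteq> W2"
      by (rule open_fun_contains_box[OF W12(2,4)])
    define N where "N = max N1 N2"
    define \<epsilon> where "\<epsilon> = min \<epsilon>1 \<epsilon>2"
    have "{(x, h'). (\<forall>i<N. \<bar>x i - unmove y h i\<bar> < \<epsilon>) \<and> (\<forall>i<N. \<bar>h' i - h i\<bar> < \<epsilon>)} \<subseteq> W1 \<times> W2"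
      using 1(2) 2(2) by (auto simp: N_def \<epsilon>_def)
    then have "good b (V N \<epsilon> (move (unmove y h) h))"
      using W12(5) 1(1) 2(1) by (intro good_box[OF W(1,2)]) (auto simp: \<epsilon>_def)
    moreover have "y \<in> V N \<epsilon> y" using 1 2 by (auto simp: V_def \<epsilon>_def)
    ultimately show ?thesis by (metis move_unmove(1))
  qed
  have good_Nil: "good [] UNIV"
  proof -
    have "linked [] [] z" for z
      unfolding linked_def using hom[of "fst z" "snd z"] struct_iso_imp_tuple_iso[of ar _ _ "[]"]
      by (metis tuple_iso_length length_0_conv)
    then have "good [] (V 0 1 (move (\<lambda>_. 0) (\<lambda>_. 0)))"
      by (intro good_box[of UNIV "[]" "[]"]) (auto simp: B_def chart_def)
    then show ?thesis by (simp add: V_def)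
  qed
  \<comment> \<open>A point with the same type of \<open>b\<close> as \<open>y\<close> lies so close
    to \<open>y'\<close> that local constancy gives the atomic fact the same value at both.\<close>
  have atomic: "g y r (map ((!) b) js) \<longleftrightarrow> g y' r (map ((!) b) js)"
    if H: "good b U" "y \<in> C \<inter> U" "y' \<in> C \<inter> U" "\<forall>i\<in>set js. i < length b" "length js = ar r" for b U y y' js r
  proof -
    have "y' \<in> C0" using H(3) \<open>C \<subseteq> C0\<close> by blast
    from C0[unfolded locally_constant_on_def, rule_format, OF this, of r "map ((!) b) js"]
    obtain S where S: "open S" "y' \<in> S" "\<forall>x\<in>S \<inter> C0. g x r (map ((!) b) js) \<longleftrightarrow> g y' r (map ((!) b) js)"
      by (elim exE conjE)
    then obtain y'' where y'': "y'' \<in> C \<inter> U \<inter> S" "E b y y''"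
      using H(1-3) unfolding good_def by blast
    then have "g y r (map ((!) b) js) \<longleftrightarrow> g y'' r (map ((!) b) js)"
      using tuple_iso_atomic[of ar "g y" b "g y''" b js r] H(4,5) y''(2) unfolding E_def by blast
    moreover have "g y'' r (map ((!) b) js) \<longleftrightarrow> g y' r (map ((!) b) js)"
      using S(3) y''(1) \<open>C \<subseteq> C0\<close> by blast
    ultimately show ?thesis by blast
  qed
  have "struct_iso ar (g x) (g y)" if xy: "x \<in> C" "y \<in> C" for x y
  proof -
    \<comment> \<open>\<open>p\<close> and \<open>q\<close> have the type of one tuple
      \<open>b\<close> at two points of one good set. The two points change during the construction,
      while \<open>x\<close> and \<open>y\<close> stay.\<close>
    define R where "R p q \<longleftrightarrow> (\<exists>b U x' y'. good b U \<and> x' \<in> C \<inter> U \<and> y' \<in> C \<inter> U \<and>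
      tuple_iso ar (g x) p (g x') b \<and> tuple_iso ar (g y) q (g y') b)" for p q
    text \<open>Extend \<open>b\<close> on the side of \<open>u\<close> and move \<open>v\<close> into a smaller neighbourhood of \<open>u\<close>.\<close>
    have ext: "\<exists>c' U' v' d. good (b @ [c']) U' \<and> u \<in> C \<inter> U' \<and> v' \<in> C \<inter> U' \<and>
        tuple_iso ar M (p @ [c]) (g u) (b @ [c']) \<and> tuple_iso ar N (q @ [d]) (g v') (b @ [c'])"
      if G: "good b U" "u \<in> C \<inter> U" "v \<in> C \<inter> U" "tuple_iso ar M p (g u) b" "tuple_iso ar N q (g v) b"
      for b U u v M N p q c
    proof -
      obtain c' where c': "tuple_iso ar M (p @ [c]) (g u) (b @ [c'])" using tuple_iso_extend[OF G(4)] .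
      obtain U' where U': "good (b @ [c']) U'" "u \<in> U'" using good_ex G(2) by blast
      then have "open U'" "U' \<inter> U \<noteq> {}" using G(2) by (auto simp: good_def)
      then obtain v' where v': "v' \<in> C \<inter> U \<inter> U'" "E b v v'" using G(1,3) unfolding good_def by blast
      then have "tuple_iso ar (g v') b N q" using G(5) unfolding E_def by (meson tuple_iso_sym tuple_iso_trans)
      then obtain d where "tuple_iso ar (g v') (b @ [c']) N (q @ [d])" using tuple_iso_extend by metis
      then show ?thesis using c' U' v' G(2) tuple_iso_sym by blast
    qed
    show ?thesis
    proof (rule back_and_forth[of R])
      show "R [] []" unfolding R_def using good_Nil xy tuple_iso_refl by blast
      show "\<exists>d. R (p @ [c]) (q @ [d])" if R: "R p q" for p q c
      proof -
        obtain b U x' y' where "good b U" "x' \<in> C \<inter> U" "y' \<in> C \<inter> U"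
          "tuple_iso ar (g x) p (g x') b" "tuple_iso ar (g y) q (g y') b" using R unfolding R_def by blast
        from ext[OF this, of c] show ?thesis unfolding R_def by blast
      qed
      show "\<exists>c. R (p @ [c]) (q @ [d])" if R: "R p q" for p q d
      proof -
        obtain b U x' y' where "good b U" "y' \<in> C \<inter> U" "x' \<in> C \<inter> U"
          "tuple_iso ar (g y) q (g y') b" "tuple_iso ar (g x) p (g x') b" using R unfolding R_def by blast
        from ext[OF this, of d] show ?thesis unfolding R_def by blast
      qed
      show "length p = length q" if "R p q" for p q
        using that tuple_iso_length unfolding R_def by metis
      show "p ! i = p ! j \<longleftrightarrow> q ! i = q ! j" if "R p q" "i < length p" "j < length p" for p q i j
        using that tuple_iso_nth_eq_iff tuple_iso_length unfolding R_def by metis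
      show "g x r (map ((!) p) js) \<longleftrightarrow> g y r (map ((!) q) js)"
        if "R p q" "\<forall>i\<in>set js. i < length p" "length js = ar r" for p q js r
      proof -
        obtain b U x' y' where b: "good b U" "x' \<in> C \<inter> U" "y' \<in> C \<inter> U"
          "tuple_iso ar (g x) p (g x') b" "tuple_iso ar (g y) q (g y') b" using \<open>R p q\<close> unfolding R_def by blast
        then have len: "length p = length b" "length q = length b" using tuple_iso_length by metis+
        have "g x r (map ((!) p) js) \<longleftrightarrow> g x' r (map ((!) b) js)"
          by (rule tuple_iso_atomic[OF b(4)]) (use that in auto)
        moreover have "g y r (map ((!) q) js) \<longleftrightarrow> g y' r (map ((!) b) js)"
          by (rule tuple_iso_atomic[OF b(5)]) (use that len in auto)
        moreover have "g x' r (map ((!) b) js) \<longleftrightarrow> g y' r (map ((!) b) js)"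
          by (rule atomic[OF b(1-3)]) (use that len in auto)
        ultimately show ?thesis by blast
      qed
    qed
  qed
  with gC show ?thesis by blast
qed

end

section \<open>The hairy disc\<close>

type_synonym real3 = "real \<times> real \<times> real"

definition node :: "nat \<Rightarrow> real" where "node n = (1/2) ^ (n + 1)"
text \<open>Small enough that the windows of radius \<open>2 * width n\<close> around the nodes are
  disjoint, since the nodes halve at each step.\<close>

definition width :: "nat \<Rightarrow> real" where "width n = node n / 8"

definition base :: "real3 set" where "base = {0..1} \<times> {-1..1} \<times> {0}"

text \<open>\<open>u\<close> is the height. Hairs of one fan differ in slope and so meet only at
  height 0; slopes below 1, for \<open>j < n + 3\<close>, keep them inside the window of their node.
  The second coordinate is constant, so changing \<open>t\<close> translates the fan.\<close>

definition hair_point :: "real \<Rightarrow> nat \<Rightarrow> nat \<Rightarrow> real \<Rightarrow> real3" where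
  "hair_point t n j u = (node n + u * (real j / (real n + 3)), t, u)"

definition hair :: "real \<Rightarrow> nat \<Rightarrow> nat \<Rightarrow> real3 set" where
  "hair t n j = hair_point t n j ` {0..width n}"

text \<open>The number of hairs identifies \<open>n\<close> and makes the foot a point whose removal
  leaves more than two components.\<close>

definition fan :: "real \<Rightarrow> nat \<Rightarrow> real3 set" where
  "fan t n = (\<Union>j<n+3. hair t n j)"

definition foot :: "(nat \<Rightarrow> real) \<Rightarrow> nat \<Rightarrow> real3" where
  "foot x n = (node n, tanh (x n), 0)"

definition hairy_disc :: "(nat \<Rightarrow> real) \<Rightarrow> real3 set" where
  "hairy_disc x = base \<union> (\<Union>n. fan (tanh (x n)) n)"

lemma node_pos [simp]: "0 < node n" and node_le: "node n \<le> 1/2"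
  by (auto simp: node_def power_le_one_iff)

lemma width_pos [simp]: "0 < width n"
  by (simp add: width_def)

lemma width_nonneg [simp]: "0 \<le> width n"
  by (simp add: less_imp_le)

lemma width_neq_0 [simp]: "width n \<noteq> 0"
  by (metis width_pos less_irrefl)

lemma node_less_imp: "m < n \<Longrightarrow> node n \<le> node m / 2"
proof -
  assume "m < n"
  then have "(1/2::real) ^ (n + 1) \<le> (1/2) ^ (m + 2)" by (intro power_decreasing) auto
  then show ?thesis by (simp add: node_def)
qed

lemma node_separated:
  assumes "\<bar>s - node m\<bar> \<le> 2 * width m" "\<bar>s - node n\<bar> \<le> 2 * width n" shows "m = n"
proof (rule ccontr)
  assume "m \<noteq> n"
  then consider "m < n" | "n < m" by linarith
  then show False
  proof cases
    case 1
    show ?thesis using node_less_imp[OF 1] node_pos[of m] assms unfolding width_def by linarith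
  next
    case 2
    show ?thesis using node_less_imp[OF 2] node_pos[of n] assms unfolding width_def by linarith
  qed
qed

lemma node_inj: "node m = node n \<Longrightarrow> m = n"
  by (rule node_separated[of "node m"]) auto

lemma node_tendsto: "node \<longlonglongrightarrow> 0"
proof -
  have "(\<lambda>n. (1/2::real) ^ (n + 1)) \<longlonglongrightarrow> 0"
    by (rule LIMSEQ_ignore_initial_segment, rule LIMSEQ_realpow_zero) auto
  then show ?thesis by (simp add: node_def[abs_def])
qed

lemma hair_offset:
  assumes "j < n + 3" "0 \<le> u" "u \<le> width n"
  shows "0 \<le> u * (real j / (real n + 3))" "u * (real j / (real n + 3)) \<le> u" "u * (real j / (real n + 3)) < width n"
proof -
  have j: "0 \<le> real j / (real n + 3)" "real j / (real n + 3) < 1" using assms(1) by auto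
  show "0 \<le> u * (real j / (real n + 3))" using j assms by simp
  show le: "u * (real j / (real n + 3)) \<le> u" using j assms by (intro mult_left_le) auto
  show "u * (real j / (real n + 3)) < width n"
  proof (cases "u = 0")
    case False
    then have "u * (real j / (real n + 3)) < u * 1" using j assms by (intro mult_strict_left_mono) auto
    then show ?thesis using assms by simp
  qed simp
qed

lemma hair_nth:
  assumes "q \<in> hair t n j" "j < n + 3"
  shows "\<bar>fst q - node n\<bar> < width n" "fst (snd q) = t" "0 \<le> snd (snd q)" "snd (snd q) \<le> width n"
    "fst q - node n = snd (snd q) * (real j / (real n + 3))"
proof -
  obtain u where u: "0 \<le> u" "u \<le> width n" "q = hair_point t n j u" using assms by (auto simp: hair_def)
  then show "\<bar>fst q - node n\<bar> < width n" "fst (snd q) = t" "0 \<le> snd (snd q)" "snd (snd q) \<le> width n"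
    "fst q - node n = snd (snd q) * (real j / (real n + 3))"
    using hair_offset[OF assms(2) u(1,2)] by (auto simp: hair_point_def)
qed

lemma hair_point_0: "hair_point (tanh (x n)) n j 0 = foot x n"
  by (simp add: hair_point_def foot_def)

lemma foot_in_hair: "foot x n \<in> hair (tanh (x n)) n j"
  unfolding hair_def hair_point_0[symmetric, of x n j] by (intro imageI) (simp add: less_imp_le)

lemma foot_in_base: "foot x n \<in> base"
  using node_pos[of n] node_le[of n] tanh_real_bounds[of "x n"]
  by (auto simp: foot_def base_def less_imp_le simp del: node_pos)

lemma hair_flat_imp_foot: "q \<in> hair (tanh (x n)) n j \<Longrightarrow> snd (snd q) = 0 \<Longrightarrow> q = foot x n"
  by (auto simp: hair_def hair_point_def foot_def)

text \<open>The first coordinate determines the node, and above height 0 it also determines the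
  slope.\<close>

lemma hairs_meet:
  assumes "q \<in> hair (tanh (x n)) n j" "q \<in> hair (tanh (x m)) m i" "j < n + 3" "i < m + 3" "(n, j) \<noteq> (m, i)"
  shows "q = foot x n"
proof -
  have nm: "n = m"
    by (rule node_separated[of "fst q"]) (use hair_nth[OF assms(1,3)] hair_nth[OF assms(2,4)] in auto)
  have "snd (snd q) * (real j / (real n + 3)) = snd (snd q) * (real i / (real n + 3))"
    using hair_nth(5)[OF assms(1,3)] hair_nth(5)[OF assms(2,4)] nm by auto
  moreover have "j \<noteq> i" using assms(5) nm by auto
  ultimately have "snd (snd q) = 0" by auto
  then show ?thesis using hair_flat_imp_foot[of q x n j] assms(1) by blast
qed

lemma continuous_on_hair_point [continuous_intros]: "continuous_on S (hair_point t n j)"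
  unfolding hair_point_def by (intro continuous_intros)

lemma compact_hair: "compact (hair t n j)"
  unfolding hair_def by (intro compact_continuous_image continuous_intros) auto

lemma compact_fan: "compact (fan t n)"
  unfolding fan_def by (intro compact_UN compact_hair) auto

lemma convex_hair: "convex (hair t n j)"
proof -
  have "hair t n j = (\<lambda>q. (node n, t, 0) + q) ` (\<lambda>u. u *\<^sub>R (real j / (real n + 3), 0, 1)) ` {0..width n}"
    unfolding hair_def image_image by (rule image_cong) (auto simp: hair_point_def)
  moreover have "convex ((\<lambda>u. u *\<^sub>R (real j / (real n + 3), 0::real, 1::real)) ` {0..width n})"
    by (rule convex_linear_image[OF linear_scaleR_left]) simp
  ultimately show ?thesis using convex_translation by metis
qed

section \<open>A retraction of the box onto the hairy disc\<close>

definition flat :: "real3 \<Rightarrow> real3" where "flat q = (fst q, fst (snd q), 0)"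

definition box3 :: "real3 set" where "box3 = {0..1} \<times> {-1..1} \<times> {0..1}"

text \<open>Twice as wide as the fan, which leaves a margin for interpolation, and cut off at the
  sides of the square, so that its bottom lies in \<open>base\<close>.\<close>

definition cell :: "(nat \<Rightarrow> real) \<Rightarrow> nat \<Rightarrow> real3 set" where
  "cell x n = {node n - 2 * width n..node n + 2 * width n} \<times>
     {max (-1) (tanh (x n) - 2 * width n)..min 1 (tanh (x n) + 2 * width n)} \<times> {0..2 * width n}"

lemma continuous_on_flat [continuous_intros]: "continuous_on S flat"
  unfolding flat_def by (intro continuous_intros)

text \<open>Hairs are glued to a rectangle one at a time. Each meets the earlier part in the foot
  alone, and gluing closed absolute retracts along an absolute retract gives an absolute
  retract.\<close>

lemma cell_base_fan_AR:
  shows "AR (cell x n \<inter> {q. snd (snd q) = 0} \<union> fan (tanh (x n)) n)" (is "AR (?P \<union> _)")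
proof -
  have Peq: "?P = {node n - 2 * width n..node n + 2 * width n} \<times>
     {max (-1) (tanh (x n) - 2 * width n)..min 1 (tanh (x n) + 2 * width n)} \<times> {0}"
    by (auto simp: cell_def less_imp_le)
  have tn: "max (-1) (tanh (x n) - 2 * width n) \<le> tanh (x n)" "tanh (x n) \<le> min 1 (tanh (x n) + 2 * width n)"
    using tanh_real_bounds[of "x n"] by (auto simp: less_imp_le)
  have rP: "foot x n \<in> ?P" unfolding Peq foot_def using tn by (simp add: less_imp_le)
  have "closed (?P \<union> (\<Union>j<k. hair (tanh (x n)) n j)) \<and> AR (?P \<union> (\<Union>j<k. hair (tanh (x n)) n j))" if "k \<le> n + 3" for k
    using that
  proof (induction k)
    case 0
    have "convex ?P" unfolding Peq by (intro convex_Times) auto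
    moreover have "closed ?P" unfolding Peq by (intro closed_Times) auto
    ultimately show ?case using rP convex_imp_AR by auto
  next
    case (Suc k)
    let ?S = "?P \<union> (\<Union>j<k. hair (tanh (x n)) n j)"
    have "?S \<inter> hair (tanh (x n)) n k = {foot x n}"
    proof
      show "?S \<inter> hair (tanh (x n)) n k \<subseteq> {foot x n}"
        using hair_flat_imp_foot hairs_meet[of _ x n k n] Suc.prems by fastforce
      show "{foot x n} \<subseteq> ?S \<inter> hair (tanh (x n)) n k" using rP foot_in_hair by blast
    qed
    then have I: "AR (?S \<inter> hair (tanh (x n)) n k)" by (simp add: convex_imp_AR)
    have ne: "hair (tanh (x n)) n k \<noteq> {}" using foot_in_hair by blast
    have "AR (?S \<union> hair (tanh (x n)) n k)"
    proof (rule AR_closed_Un[OF _ _ _ _ I])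
      show "closed ?S" "AR ?S" using Suc by auto
      show "closed (hair (tanh (x n)) n k)" by (rule compact_imp_closed[OF compact_hair])
      show "AR (hair (tanh (x n)) n k)" by (rule convex_imp_AR[OF convex_hair ne])
    qed
    moreover have "closed (?S \<union> hair (tanh (x n)) n k)"
      by (rule closed_Un) (use Suc compact_imp_closed[OF compact_hair] in auto)
    moreover have "?P \<union> (\<Union>j<Suc k. hair (tanh (x n)) n j) = ?S \<union> hair (tanh (x n)) n k"
      by (auto simp: lessThan_Suc)
    ultimately show ?case by simp
  qed
  from this[of "n + 3"] show ?thesis by (simp add: fan_def)
qed

lemma fan_nth:
  assumes "q \<in> fan t n"
  shows "\<bar>fst q - node n\<bar> < width n" "fst (snd q) = t" "0 \<le> snd (snd q)" "snd (snd q) \<le> width n"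
  using assms hair_nth[of q t n] unfolding fan_def by auto

lemma fan_subset_cell: "fan (tanh (x n)) n \<subseteq> cell x n"
proof
  fix q assume q: "q \<in> fan (tanh (x n)) n"
  show "q \<in> cell x n"
    using fan_nth[OF q] tanh_real_bounds[of "x n"] width_pos[of n] by (cases q) (auto simp: cell_def simp del: width_pos)
qed

lemma cell_subset_box3: "cell x n \<subseteq> box3"
  using node_le[of n] node_pos[of n] by (auto simp: cell_def box3_def width_def)

lemma base_subset_box3: "base \<subseteq> box3"
  by (auto simp: base_def box3_def)

lemma flat_box3: "q \<in> box3 \<Longrightarrow> flat q \<in> base"
  by (auto simp: flat_def base_def box3_def)

lemma flat_base: "q \<in> base \<Longrightarrow> flat q = q"
  by (auto simp: flat_def base_def)

lemma cell_disjoint: "q \<in> cell x m \<Longrightarrow> q \<in> cell x n \<Longrightarrow> m = n"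
  by (rule node_separated[of "fst q"]) (auto simp: cell_def)

text \<open>A local correction of the vertical projection \<open>flat\<close>: inside the cell,
  \<open>flat q + u q\<close> retracts onto the bottom and the fan; outside it, \<open>u\<close>
  vanishes. The bound on \<open>u\<close> makes the sum over all cells converge uniformly.\<close>

lemma ex_cell_correction:
  obtains u where "continuous_on box3 u" "\<And>q. q \<in> box3 \<Longrightarrow> norm (u q) \<le> 12 * width n"
    "\<And>q. q \<notin> cell x n \<Longrightarrow> u q = 0" "\<And>q. q \<in> base \<Longrightarrow> u q = 0"
    "\<And>q. q \<in> fan (tanh (x n)) n \<Longrightarrow> flat q + u q = q"
    "\<And>q. q \<in> cell x n \<Longrightarrow> flat q + u q \<in> hairy_disc x"
proof -
  define B where "B = cell x n"
  define F where "F = fan (tanh (x n)) n"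
  define P where "P = B \<inter> {q. snd (snd q) = 0}"
  \<comment> \<open>In \<open>box3\<close>, this is the outside of the cell together with the walls
    facing it; there the correction has to vanish.\<close>
  define far where "far = {q::real3. 2 * width n \<le> \<bar>fst q - node n\<bar> \<or> 2 * width n \<le> \<bar>fst (snd q) - tanh (x n)\<bar> \<or> 2 * width n \<le> snd (snd q)}"
  have far: "closed far"
    unfolding far_def by (intro closed_Collect_disj closed_Collect_le continuous_intros)
  have B: "closed B" unfolding B_def cell_def by (intro closed_Times) auto
  have cF: "closed F" unfolding F_def using compact_fan by (rule compact_imp_closed)
  have cP: "closed P" unfolding P_def by (intro closed_Int B closed_Collect_eq continuous_intros)
  have ARPF: "AR (P \<union> F)" using cell_base_fan_AR unfolding P_def F_def B_def .
  have FB: "F \<subseteq> B" unfolding F_def B_def by (rule fan_subset_cell)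
  have flatB: "flat q \<in> P" if "q \<in> B" for q
    using that by (auto simp: P_def B_def cell_def flat_def less_imp_le)
  have flatP: "flat q = q" if "q \<in> P" for q
    using that by (auto simp: P_def flat_def prod_eq_iff)
  have Ffar: "F \<inter> far = {}"
    using fan_nth[of _ "tanh (x n)" n] width_pos[of n] by (fastforce simp: F_def far_def)
  have flatF: "flat q = q" if "q \<in> F" "q \<in> P \<union> (B \<inter> far)" for q
    using that Ffar flatP[of q] by auto
  \<comment> \<open>Identity on the fan, projection on the bottom and the walls. The fan misses
    \<open>far\<close>, and \<open>flat\<close> fixes the bottom, so the two rules agree where they
    meet.\<close>
  define f where "f q = (if q \<in> F then q else flat q)" for q
  have cont_f: "continuous_on (F \<union> (P \<union> (B \<inter> far))) f"
    unfolding f_def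
    by (intro continuous_on_cases cF closed_Un cP closed_Int B far continuous_on_id continuous_on_flat)
       (use flatF in auto)
  have im_f: "f ` (F \<union> (P \<union> (B \<inter> far))) \<subseteq> P \<union> F"
    using flatB FB by (auto simp: f_def P_def)
  have clo: "closedin (top_of_set B) (F \<union> (P \<union> (B \<inter> far)))"
    by (rule closed_subset) (use FB cF cP B far in \<open>auto simp: P_def\<close>)
  have "\<exists>r. continuous_on B r \<and> r ` B \<subseteq> P \<union> F \<and> (\<forall>q\<in>F \<union> (P \<union> (B \<inter> far)). r q = f q)"
    by (rule AR_imp_absolute_extensor[OF ARPF cont_f im_f clo]) blast
  then obtain r where r: "continuous_on B r" "r ` B \<subseteq> P \<union> F"
    "\<forall>q\<in>F \<union> (P \<union> (B \<inter> far)). r q = f q"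
    by (elim exE conjE)
  define u where "u q = (if q \<in> B then r q - flat q else 0)" for q
  have u0: "u q = 0" if "q \<in> P \<or> q \<in> far" for q
    using that r(3)[rule_format, of q] flatF[of q] flatP[of q] Ffar by (auto simp: u_def f_def P_def)
  have sub: "box3 \<subseteq> B \<union> far"
  proof
    fix q :: real3 assume "q \<in> box3"
    then show "q \<in> B \<union> far"
      by (cases q) (auto simp: B_def cell_def far_def box3_def)
  qed
  have "r q = flat q" if "q \<in> far" "q \<in> B" for q
    using u0[of q] that by (simp add: u_def)
  then have "continuous_on (B \<union> far) u"
    unfolding u_def by (intro continuous_on_cases B far continuous_intros r) auto
  then have "continuous_on box3 u" using sub by (rule continuous_on_subset)
  \<comment> \<open>Both points lie in the cell, so each of the three coordinates changes by at most
    \<open>4 * width n\<close>.\<close>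
  moreover have "norm (u q) \<le> 12 * width n" if "q \<in> box3" for q
  proof (cases "q \<in> B")
    case True
    have PFB: "P \<union> F \<subseteq> B" using FB by (auto simp: P_def)
    have "r q \<in> B" using r(2) True PFB by blast
    moreover have "flat q \<in> B" using flatB[OF True] PFB by blast
    ultimately have "\<bar>fst (r q) - fst (flat q)\<bar> \<le> 4 * width n" "\<bar>fst (snd (r q)) - fst (snd (flat q))\<bar> \<le> 4 * width n"
      "\<bar>snd (snd (r q)) - snd (snd (flat q))\<bar> \<le> 4 * width n"
      by (auto simp: B_def cell_def)
    moreover have "norm v \<le> \<bar>fst v\<bar> + (\<bar>fst (snd v)\<bar> + \<bar>snd (snd v)\<bar>)" for v :: real3
      using norm_Pair_le[of "fst v" "snd v"] norm_Pair_le[of "fst (snd v)" "snd (snd v)"] by simp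
    from this[of "r q - flat q"] have "norm (r q - flat q) \<le> \<bar>fst (r q) - fst (flat q)\<bar> + (\<bar>fst (snd (r q)) - fst (snd (flat q))\<bar> + \<bar>snd (snd (r q)) - snd (snd (flat q))\<bar>)"
      by simp
    ultimately show ?thesis using True by (simp add: u_def)
  qed (simp add: u_def less_imp_le)
  moreover have "u q = 0" if "q \<notin> cell x n" for q using that by (simp add: u_def B_def)
  moreover have "u q = 0" if "q \<in> base" for q
    using that u0[of q] by (cases "q \<in> B") (auto simp: P_def u_def base_def)
  moreover have "flat q + u q = q" if "q \<in> fan (tanh (x n)) n" for q
    using that r(3)[rule_format, of q] FB by (auto simp: u_def f_def F_def)
  moreover have "flat q + u q \<in> hairy_disc x" if "q \<in> cell x n" for q
  proof -
    have "flat q + u q \<in> P \<union> F" using that r(2) by (auto simp: u_def B_def)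
    moreover have "P \<subseteq> base" using cell_subset_box3[of x n] by (auto simp: P_def B_def base_def box3_def)
    ultimately show ?thesis by (auto simp: hairy_disc_def F_def)
  qed
  ultimately show ?thesis by (rule that)
qed

text \<open>Add all corrections to \<open>flat\<close>. The cells are disjoint, so at most one term
  is nonzero at each point, and the M-test with the summable widths gives continuity.\<close>

lemma hairy_disc_retract: "hairy_disc x retract_of box3"
proof -
  have "\<forall>n. \<exists>u. continuous_on box3 u \<and> (\<forall>q\<in>box3. norm (u q) \<le> 12 * width n) \<and>
    (\<forall>q. q \<notin> cell x n \<longrightarrow> u q = 0) \<and> (\<forall>q\<in>base. u q = 0) \<and>
    (\<forall>q\<in>fan (tanh (x n)) n. flat q + u q = q) \<and> (\<forall>q\<in>cell x n. flat q + u q \<in> hairy_disc x)"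
    by (intro allI, rule_tac x = x and n = n in ex_cell_correction, rule_tac x = u in exI) auto
  from choice[OF this] obtain u where u: "\<forall>n. continuous_on box3 (u n) \<and> (\<forall>q\<in>box3. norm (u n q) \<le> 12 * width n) \<and>
    (\<forall>q. q \<notin> cell x n \<longrightarrow> u n q = 0) \<and> (\<forall>q\<in>base. u n q = 0) \<and>
    (\<forall>q\<in>fan (tanh (x n)) n. flat q + u n q = q) \<and> (\<forall>q\<in>cell x n. flat q + u n q \<in> hairy_disc x)"
    by (elim exE)
  define r where "r q = flat q + (\<Sum>n. u n q)" for q
  have single: "(\<Sum>n. u n q) = u m q" if "\<And>n. n \<noteq> m \<Longrightarrow> u n q = 0" for m q
    using suminf_finite[of "{m}" "\<lambda>n. u n q"] that by auto
  have "summable (\<lambda>n. 12 * width n)"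
    unfolding width_def node_def by (intro summable_mult summable_divide) (simp add: summable_geometric)
  then have "uniform_limit box3 (\<lambda>n q. \<Sum>i<n. u i q) (\<lambda>q. \<Sum>i. u i q) sequentially"
    by (intro Weierstrass_m_test[where M = "\<lambda>n. 12 * width n"]) (use u in auto)
  then have "continuous_on box3 (\<lambda>q. \<Sum>i. u i q)"
    by (rule uniform_limit_theorem[rotated]) (use u in \<open>auto intro!: always_eventually continuous_on_sum\<close>)
  then have "continuous_on box3 r"
    unfolding r_def by (intro continuous_intros)
  moreover have "r q = q" if q: "q \<in> hairy_disc x" for q
  proof (cases "q \<in> base")
    case True
    then have "(\<Sum>n. u n q) = 0" using u by simp
    then show ?thesis using flat_base[OF True] by (simp add: r_def)
  next
    case False
    with q obtain m where m: "q \<in> fan (tanh (x m)) m" by (auto simp: hairy_disc_def)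
    have "(\<Sum>n. u n q) = u m q"
      by (rule single) (use u cell_disjoint fan_subset_cell m in blast)
    then show ?thesis using u m by (simp add: r_def)
  qed
  moreover have "r q \<in> hairy_disc x" if "q \<in> box3" for q
  proof (cases "\<exists>m. q \<in> cell x m")
    case True
    then obtain m where m: "q \<in> cell x m" by blast
    have "(\<Sum>n. u n q) = u m q"
      by (rule single) (use u cell_disjoint m in blast)
    then show ?thesis using u m by (simp add: r_def)
  next
    case False
    then have "u n q = 0" for n using u by blast
    then have "(\<Sum>n. u n q) = 0" by simp
    then show ?thesis using flat_box3[OF that] by (simp add: r_def hairy_disc_def)
  qed
  moreover have "hairy_disc x \<subseteq> box3"
    using base_subset_box3 cell_subset_box3 fan_subset_cell by (fastforce simp: hairy_disc_def)
  ultimately show ?thesis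
    unfolding retract_of_def retraction_def by (intro exI[of _ r]) auto
qed

lemma hairy_disc_AR: "AR (hairy_disc x)"
proof (rule AR_retract_of_AR[OF _ hairy_disc_retract])
  show "AR box3" unfolding box3_def by (intro convex_imp_AR convex_Times) auto
qed

lemma compact_hairy_disc: "compact (hairy_disc x)"
proof (rule retract_of_compact[OF _ hairy_disc_retract])
  show "compact box3" unfolding box3_def by (intro compact_Times) auto
qed

section \<open>Borel dependence\<close>

definition embed3 :: "real3 \<Rightarrow> real^3" where
  "embed3 q = fst q *\<^sub>R axis 1 1 + fst (snd q) *\<^sub>R axis 2 1 + snd (snd q) *\<^sub>R axis 3 1"

lemma embed3_nth: "embed3 q $ 1 = fst q" "embed3 q $ 2 = fst (snd q)" "embed3 q $ 3 = snd (snd q)"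
  by (simp_all add: embed3_def axis_def)

lemma continuous_on_embed3: "continuous_on S embed3"
  unfolding embed3_def by (intro continuous_intros)

lemma homeomorphism_embed3: "homeomorphism S (embed3 ` S) embed3 (\<lambda>v. (v $ 1, v $ 2, v $ 3))"
  by (rule homeomorphismI) (auto simp: embed3_nth intro!: continuous_on_embed3 continuous_intros)

definition hairy_AR :: "(nat \<Rightarrow> real) \<Rightarrow> (real^3) set" where
  "hairy_AR x = embed3 ` hairy_disc x"

lemma hairy_AR_homeomorphic: "hairy_disc x homeomorphic hairy_AR x"
  unfolding hairy_AR_def homeomorphic_def using homeomorphism_embed3 by blast

lemma hairy_AR_in_AR_R3: "hairy_AR x \<in> AR_R3"
proof -
  have "AR (hairy_AR x)" using homeomorphic_AR_iff_AR[OF hairy_AR_homeomorphic] hairy_disc_AR by blast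
  moreover have "compact (hairy_AR x)"
    unfolding hairy_AR_def by (intro compact_continuous_image continuous_on_embed3 compact_hairy_disc)
  ultimately show ?thesis by (simp add: AR_R3_def)
qed

lemma continuous_on_tanh_coord: "continuous_on S (\<lambda>x::nat \<Rightarrow> real. tanh (x n))"
  by (intro continuous_intros continuous_on_product_then_coordinatewise[OF continuous_on_id, simplified]) simp

lemma fan_translate:
  assumes "q \<in> fan t n" shows "(fst q, t', snd (snd q)) \<in> fan t' n"
  using assms by (force simp: fan_def hair_def hair_point_def)

lemma fan_near_base:
  assumes "q \<in> fan t n" "\<bar>t\<bar> \<le> 1"
  shows "flat q \<in> base" "dist (flat q) q \<le> width n"
proof -
  have q: "\<bar>fst q - node n\<bar> < width n" "fst (snd q) = t" "0 \<le> snd (snd q)" "snd (snd q) \<le> width n"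
    using fan_nth[OF assms(1)] by auto
  have "0 \<le> fst q" "fst q \<le> 1"
    using q(1) node_le[of n] node_pos[of n] unfolding width_def by linarith+
  then show "flat q \<in> base" using q(2) assms(2) by (auto simp: flat_def base_def)
  show "dist (flat q) q \<le> width n"
    using q by (cases q) (auto simp: flat_def dist_Pair_Pair dist_real_def)
qed

lemma width_tendsto: "width \<longlonglongrightarrow> 0"
proof -
  have "(\<lambda>n. node n / 8) \<longlonglongrightarrow> 0 / 8" by (intro tendsto_intros node_tendsto) simp
  then show ?thesis by (simp add: width_def[abs_def])
qed

text \<open>Finitely many fans follow \<open>x\<close> continuously; the remaining ones rise less
  than \<open>\<epsilon>\<close> above the base and stay near it wherever they stand.\<close>

lemma open_hairy_disc_subset:
  assumes "open V" shows "open {x. hairy_disc x \<subseteq> V}"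
proof (subst open_subopen, intro ballI)
  fix x assume "x \<in> {x. hairy_disc x \<subseteq> V}"
  then obtain \<epsilon> where \<epsilon>: "\<epsilon> > 0" "(\<Union>q\<in>hairy_disc x. ball q \<epsilon>) \<subseteq> V"
    using compact_subset_open_imp_ball_epsilon_subset[OF compact_hairy_disc assms] by auto
  obtain N where N: "\<And>n. n \<ge> N \<Longrightarrow> width n < \<epsilon>"
    using order_tendstoD(2)[OF width_tendsto \<epsilon>(1)] by (auto simp: eventually_sequentially)
  define U where "U = (\<Inter>n\<in>{..<N}. {y::nat \<Rightarrow> real. \<bar>tanh (y n) - tanh (x n)\<bar> < \<epsilon>})"
  have "open U" unfolding U_def
    by (intro open_INT finite_lessThan ballI open_Collect_less continuous_on_rabs continuous_on_diff
        continuous_on_tanh_coord continuous_on_const)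
  moreover have "x \<in> U" using \<epsilon> by (simp add: U_def)
  moreover have "q \<in> V" if y: "y \<in> U" "q \<in> hairy_disc y" for y q
  proof (cases "q \<in> base")
    case True
    then have "q \<in> hairy_disc x" by (simp add: hairy_disc_def)
    then have "q \<in> (\<Union>q\<in>hairy_disc x. ball q \<epsilon>)" using \<epsilon>(1) centre_in_ball[of q \<epsilon>] by blast
    then show ?thesis using \<epsilon>(2) by blast
  next
    case False
    with y obtain n where n: "q \<in> fan (tanh (y n)) n" by (auto simp: hairy_disc_def)
    have "\<exists>q'\<in>hairy_disc x. dist q' q < \<epsilon>"
    proof (cases "n < N")
      case True
      let ?q = "(fst q, tanh (x n), snd (snd q))"
      have "?q \<in> hairy_disc x" using fan_translate[OF n] by (auto simp: hairy_disc_def)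
      moreover have "dist ?q q < \<epsilon>"
        using y(1) True fan_nth(2)[OF n]
        by (cases q) (auto simp: U_def dist_Pair_Pair dist_real_def abs_minus_commute)
      ultimately show ?thesis by blast
    next
      case False
      have "\<bar>tanh (y n)\<bar> \<le> 1" using tanh_real_bounds[of "y n"] by auto
      from fan_near_base[OF n this] have "flat q \<in> hairy_disc x" "dist (flat q) q < \<epsilon>"
        using N[of n] False by (auto simp: hairy_disc_def)
      then show ?thesis by blast
    qed
    then have "q \<in> (\<Union>q\<in>hairy_disc x. ball q \<epsilon>)" by (simp add: mem_ball)
    then show ?thesis using \<epsilon>(2) by blast
  qed
  ultimately show "\<exists>T. open T \<and> x \<in> T \<and> T \<subseteq> {x. hairy_disc x \<subseteq> V}" by blast
qed

text \<open>A point of fan \<open>n\<close> travels continuously with the coordinate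
  \<open>x n\<close> when the fan is translated.\<close>

lemma open_hairy_disc_meets:
  assumes "open V" shows "open {x. hairy_disc x \<inter> V \<noteq> {}}"
proof (subst open_subopen, intro ballI)
  fix x assume "x \<in> {x. hairy_disc x \<inter> V \<noteq> {}}"
  then obtain q where q: "q \<in> hairy_disc x" "q \<in> V" by blast
  show "\<exists>T. open T \<and> x \<in> T \<and> T \<subseteq> {x. hairy_disc x \<inter> V \<noteq> {}}"
  proof (cases "q \<in> base")
    case True
    then have "q \<in> hairy_disc y" for y by (simp add: hairy_disc_def)
    then have "UNIV \<subseteq> {x. hairy_disc x \<inter> V \<noteq> {}}" using q(2) by blast
    then show ?thesis by (intro exI[of _ UNIV]) auto
  next
    case False
    with q obtain n where n: "q \<in> fan (tanh (x n)) n" by (auto simp: hairy_disc_def)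
    define \<phi> where "\<phi> y = (fst q, tanh (y n), snd (snd q))" for y :: "nat \<Rightarrow> real"
    have "continuous_on UNIV \<phi>"
      unfolding \<phi>_def by (intro continuous_on_Pair continuous_on_const continuous_on_tanh_coord)
    then have "open (\<phi> -` V)" using assms by (rule open_vimage[rotated])
    moreover have "\<phi> x = q" using fan_nth(2)[OF n] by (simp add: \<phi>_def prod_eq_iff)
    moreover have "\<phi> y \<in> hairy_disc y" for y
      using fan_translate[OF n] by (auto simp: \<phi>_def hairy_disc_def)
    then have "\<phi> -` V \<subseteq> {x. hairy_disc x \<inter> V \<noteq> {}}" by blast
    ultimately show ?thesis using q(2) by (intro exI[of _ "\<phi> -` V"]) auto
  qed
qed

lemma hairy_AR_vietoris_continuous:
  assumes "openin vietoris S" shows "open (hairy_AR -` S)"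
proof -
  have "generate_topology_on ({{K. compact K \<and> K \<subseteq> U} | U. open U} \<union>
      {{K. compact K \<and> K \<inter> U \<noteq> {}} | U. open U}) S"
    using assms by (simp add: vietoris_def openin_topology_generated_by_iff)
  then show ?thesis
  proof induction
    case (Basis s)
    have comp: "compact (hairy_AR x)" for x using hairy_AR_in_AR_R3[of x] by (simp add: AR_R3_def)
    from Basis show ?case
    proof (elim UnE CollectE exE conjE)
      fix U assume U: "s = {K. compact K \<and> K \<subseteq> U}" "open U"
      have "hairy_AR -` s = {x. hairy_disc x \<subseteq> embed3 -` U}"
        using comp by (auto simp: U hairy_AR_def)
      then show ?thesis using U(2) continuous_on_embed3 by (simp add: open_hairy_disc_subset open_vimage)
    next
      fix U assume U: "s = {K. compact K \<and> K \<inter> U \<noteq> {}}" "open U"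
      have "hairy_AR -` s = {x. hairy_disc x \<inter> embed3 -` U \<noteq> {}}"
        using comp by (auto simp: U hairy_AR_def)
      then show ?thesis using U(2) continuous_on_embed3 by (simp add: open_hairy_disc_meets open_vimage)
    qed
  next
    case (UN K)
    have "hairy_AR -` (\<Union>K) = (\<Union>k\<in>K. hairy_AR -` k)" by blast
    then show ?case using UN by auto
  qed auto
qed

lemma hairy_AR_measurable:
  "hairy_AR \<in> measurable borel (restrict_space (borel_of vietoris) AR_R3)"
proof (rule measurable_restrict_space2)
  show "hairy_AR \<in> measurable borel (borel_of vietoris)"
    unfolding borel_of_def
  proof (rule measurable_measure_of)
    show "{U. openin vietoris U} \<subseteq> Pow (topspace vietoris)" using openin_subset by blast
    have "{K :: (real^3) set. compact K \<and> K \<subseteq> UNIV} \<in> {{K. compact K \<and> K \<subseteq> U} | U. open U}"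
      using open_UNIV by blast
    then have "{K :: (real^3) set. compact K \<and> K \<subseteq> UNIV} \<subseteq> topspace vietoris"
      unfolding vietoris_def topology_generated_by_topspace by (intro Union_upper UnI1)
    then have "AR_R3 \<subseteq> topspace vietoris" by (auto simp: AR_R3_def)
    then show "hairy_AR \<in> space borel \<rightarrow> topspace vietoris" using hairy_AR_in_AR_R3 by blast
  qed (use hairy_AR_vietoris_continuous in auto)
qed (use hairy_AR_in_AR_R3 in blast)

section \<open>Homeomorphisms along moves\<close>

text \<open>On each line of constant first coordinate this is the addition theorem of
  \<open>tanh\<close>: where \<open>\<alpha> s = tanh d\<close>, it takes \<open>tanh u\<close> to
  \<open>tanh (u + d)\<close>. It fixes the ends -1 and 1, so the square is preserved.\<close>

definition shear :: "(real \<Rightarrow> real) \<Rightarrow> real3 \<Rightarrow> real3" where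
  "shear \<alpha> q = (fst q, (fst (snd q) + \<alpha> (fst q)) / (1 + fst (snd q) * \<alpha> (fst q)), snd (snd q))"

lemma moebius_denominator_pos:
  fixes t a :: real assumes "\<bar>t\<bar> \<le> 1" "\<bar>a\<bar> < 1" shows "0 < 1 + t * a"
proof -
  have "\<bar>t * a\<bar> \<le> 1 * \<bar>a\<bar>" unfolding abs_mult using assms by (intro mult_right_mono) auto
  then show ?thesis using assms by linarith
qed

lemma moebius_bounded:
  fixes t a :: real assumes "\<bar>t\<bar> \<le> 1" "\<bar>a\<bar> < 1" shows "\<bar>(t + a) / (1 + t * a)\<bar> \<le> 1"
proof -
  have "0 \<le> (1 - t) * (1 - a)" "0 \<le> (1 + t) * (1 + a)" using assms by (auto intro!: mult_nonneg_nonneg)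
  then have "t + a \<le> 1 + t * a" "- (1 + t * a) \<le> t + a" by (auto simp: algebra_simps)
  then show ?thesis using moebius_denominator_pos[OF assms] by (auto simp: abs_le_iff field_simps)
qed

lemma moebius_inverse:
  fixes t a :: real assumes "\<bar>t\<bar> \<le> 1" "\<bar>a\<bar> < 1"
  shows "((t + a) / (1 + t * a) + (- a)) / (1 + (t + a) / (1 + t * a) * (- a)) = t"
proof -
  define d where "d = 1 + t * a"
  have d: "d > 0" unfolding d_def by (rule moebius_denominator_pos[OF assms])
  have a2: "1 - a * a \<noteq> 0" using assms(2) abs_square_less_1[of a] by (simp add: power2_eq_square)
  have "(t + a) / d + (- a) = t * (1 - a * a) / d" using d by (simp add: d_def field_simps)
  moreover have "1 + (t + a) / d * (- a) = (1 - a * a) / d" using d by (simp add: d_def field_simps)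
  ultimately show ?thesis using a2 d unfolding d_def[symmetric] by simp
qed

lemma hairy_disc_abs_le: "q \<in> hairy_disc x \<Longrightarrow> \<bar>fst (snd q)\<bar> \<le> 1"
  using fan_subset_cell cell_subset_box3 base_subset_box3 unfolding hairy_disc_def box3_def by fastforce

text \<open>On a plateau \<open>\<alpha>\<close> is constant, hence the whole fan, which lies over
  it, is translated to the new foot without distortion.\<close>

lemma shear_hairy_disc:
  assumes small: "\<And>s. \<bar>\<alpha> s\<bar> < 1" and plateau: "\<And>n s. \<bar>s - node n\<bar> \<le> width n \<Longrightarrow> \<alpha> s = tanh (y n - x n)"
    and q: "q \<in> hairy_disc x"
  shows "shear \<alpha> q \<in> hairy_disc y"
proof (cases "q \<in> base")
  case True
  then have "\<bar>fst (snd q)\<bar> \<le> 1" by (auto simp: base_def)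
  from moebius_bounded[OF this small[of "fst q"], THEN abs_le_iff[THEN iffD1]] True
  have "shear \<alpha> q \<in> base" by (auto simp: shear_def base_def)
  then show ?thesis by (simp add: hairy_disc_def)
next
  case False
  with q obtain n where n: "q \<in> fan (tanh (x n)) n" by (auto simp: hairy_disc_def)
  have "\<alpha> (fst q) = tanh (y n - x n)" by (rule plateau) (use fan_nth(1)[OF n] in simp)
  then have "shear \<alpha> q = (fst q, tanh (y n), snd (snd q))"
    using fan_nth(2)[OF n] tanh_add[of "x n" "y n - x n"] by (simp add: shear_def)
  then show ?thesis using fan_translate[OF n, of "tanh (y n)"] by (auto simp: hairy_disc_def)
qed

lemma continuous_on_shear:
  assumes "continuous_on UNIV \<alpha>" "\<And>s. \<bar>\<alpha> s\<bar> < 1"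
  shows "continuous_on (hairy_disc x) (shear \<alpha>)"
proof -
  have "1 + fst (snd q) * \<alpha> (fst q) \<noteq> 0" if "q \<in> hairy_disc x" for q
    using moebius_denominator_pos[OF hairy_disc_abs_le[OF that] assms(2)[of "fst q"]] by simp
  moreover have "continuous_on (hairy_disc x) (\<lambda>q. \<alpha> (fst q))"
    by (rule continuous_on_compose2[OF assms(1)]) (auto intro: continuous_intros)
  ultimately show ?thesis unfolding shear_def by (intro continuous_intros) auto
qed

text \<open>The inverse is the shear with \<open>- \<alpha>\<close>, by
  \<open>moebius_inverse\<close>.\<close>

lemma shear_homeomorphic:
  assumes cont: "continuous_on UNIV \<alpha>" and small: "\<And>s. \<bar>\<alpha> s\<bar> < 1"
    and plateau: "\<And>n s. \<bar>s - node n\<bar> \<le> width n \<Longrightarrow> \<alpha> s = tanh (y n - x n)"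
  shows "hairy_disc x homeomorphic hairy_disc y"
proof -
  define \<beta> where "\<beta> s = - \<alpha> s" for s
  have \<beta>: "continuous_on UNIV \<beta>" "\<And>s. \<bar>\<beta> s\<bar> < 1"
    "\<And>n s. \<bar>s - node n\<bar> \<le> width n \<Longrightarrow> \<beta> s = tanh (x n - y n)"
    using small plateau tanh_minus[of "y _ - x _"]
    by (auto simp: \<beta>_def intro!: continuous_intros cont)
  have inv: "shear \<beta> (shear \<alpha> q) = q" if "q \<in> hairy_disc x" for q
    using moebius_inverse[OF hairy_disc_abs_le[OF that] small[of "fst q"]]
    by (simp add: shear_def \<beta>_def prod_eq_iff)
  have inv': "shear \<alpha> (shear \<beta> q) = q" if "q \<in> hairy_disc y" for q
    using moebius_inverse[OF hairy_disc_abs_le[OF that] \<beta>(2)[of "fst q"]]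
    by (simp add: shear_def \<beta>_def prod_eq_iff)
  have "homeomorphism (hairy_disc x) (hairy_disc y) (shear \<alpha>) (shear \<beta>)"
  proof (rule homeomorphismI)
    show "continuous_on (hairy_disc x) (shear \<alpha>)" by (rule continuous_on_shear[OF cont small])
    show "continuous_on (hairy_disc y) (shear \<beta>)" by (rule continuous_on_shear[OF \<beta>(1,2)])
    show "shear \<alpha> ` hairy_disc x \<subseteq> hairy_disc y" by (intro image_subsetI shear_hairy_disc[where x = x] small plateau)
    show "shear \<beta> ` hairy_disc y \<subseteq> hairy_disc x" by (intro image_subsetI shear_hairy_disc[where x = y] \<beta>)
  qed (use inv inv' in auto)
  then show ?thesis unfolding homeomorphic_def by blast
qed

lemma abs_tanh_le: "\<bar>tanh d\<bar> \<le> \<bar>d :: real\<bar>"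
proof -
  have "tanh u \<le> u" if "0 \<le> u" for u :: real
  proof -
    have "0 - tanh 0 \<le> u - tanh u"
    proof (rule DERIV_nonneg_imp_nondecreasing[OF that])
      fix v :: real
      have "((\<lambda>v. v - tanh v) has_real_derivative 1 - (1 - tanh v ^ 2)) (at v)"
        by (auto intro!: derivative_eq_intros)
      then show "\<exists>y. ((\<lambda>v. v - tanh v) has_real_derivative y) (at v) \<and> 0 \<le> y" by force
    qed
    then show ?thesis by simp
  qed
  from this[of "\<bar>d\<bar>"] show ?thesis by simp
qed

text \<open>A trapezoid: 1 over the fan, 0 from distance \<open>2 * width n\<close> on, so that
  different bumps have disjoint supports.\<close>

definition bump :: "nat \<Rightarrow> real \<Rightarrow> real" where
  "bump n s = max 0 (min 1 (2 - \<bar>s - node n\<bar> / width n))"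

lemma bump_le: "\<bar>bump n s\<bar> \<le> 1"
  by (simp add: bump_def)

lemma bump_plateau: "\<bar>s - node n\<bar> \<le> width n \<Longrightarrow> bump n s = 1"
  by (simp add: bump_def field_simps)

lemma bump_off_plateau:
  assumes "\<bar>s - node n\<bar> \<le> width n" "m \<noteq> n" shows "bump m s = 0"
proof -
  have "\<bar>s - node n\<bar> \<le> 2 * width n" using assms(1) width_pos[of n] by linarith
  then have "\<not> \<bar>s - node m\<bar> \<le> 2 * width m" using node_separated assms(2) by blast
  then have "2 < \<bar>s - node m\<bar> / width m" by (simp add: field_simps)
  then show ?thesis by (simp add: bump_def)
qed

text \<open>The shear uses one bump of height \<open>tanh (d n)\<close> per fan, \<open>d n\<close>
  being the displacement. The factors in \<open>move\<close> bound these heights by a geometric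
  series of sum 1/2, which gives continuity of \<open>\<alpha>\<close> and keeps it below 1.\<close>

theorem hairy_disc_move: "hairy_disc x homeomorphic hairy_disc (move x h)"
proof -
  define d where "d n = (1/2) ^ (n + 2) * tanh (h n)" for n
  define \<alpha> where "\<alpha> s = (\<Sum>n. tanh (d n) * bump n s)" for s
  have d: "\<bar>tanh (d n) * bump n s\<bar> \<le> (1/2) ^ (n + 2)" for n s
  proof -
    have "\<bar>tanh (h n)\<bar> \<le> 1" using tanh_real_bounds[of "h n"] by auto
    then have "\<bar>d n\<bar> \<le> (1/2) ^ (n + 2) * 1"
      unfolding d_def abs_mult by (intro mult_mono) auto
    then have "\<bar>tanh (d n)\<bar> \<le> (1/2) ^ (n + 2)" using abs_tanh_le[of "d n"] by linarith
    then have "\<bar>tanh (d n)\<bar> * \<bar>bump n s\<bar> \<le> (1/2) ^ (n + 2) * 1"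
      using bump_le by (intro mult_mono) auto
    then show ?thesis by (simp add: abs_mult)
  qed
  have sums: "(\<lambda>n. (1/2::real) ^ (n + 2)) sums (1/2)"
    using sums_mult[OF geometric_sums[of "1/2::real"], of "1/4"] by (simp add: power2_eq_square)
  then have sm: "summable (\<lambda>n. (1/2::real) ^ (n + 2))" by (rule sums_summable)
  have "uniform_limit UNIV (\<lambda>n s. \<Sum>i<n. tanh (d i) * bump i s) \<alpha> sequentially"
    unfolding \<alpha>_def by (rule Weierstrass_m_test[OF _ sm]) (use d in simp)
  then have cont: "continuous_on UNIV \<alpha>"
    by (rule uniform_limit_theorem[rotated])
       (auto simp: bump_def intro!: always_eventually continuous_intros)
  have "\<bar>\<alpha> s\<bar> \<le> 1/2" for s
  proof -
    have sa: "summable (\<lambda>n. \<bar>tanh (d n) * bump n s\<bar>)"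
      by (rule summable_comparison_test'[OF sm]) (use d in simp)
    have "\<bar>\<alpha> s\<bar> \<le> (\<Sum>n. \<bar>tanh (d n) * bump n s\<bar>)"
      unfolding \<alpha>_def using sa by (rule summable_rabs)
    also have "\<dots> \<le> (\<Sum>n. (1/2) ^ (n + 2))" by (rule suminf_le) (use d sm sa in auto)
    also have "\<dots> = 1/2" using sums by (simp add: sums_iff)
    finally show ?thesis .
  qed
  then have small: "\<bar>\<alpha> s\<bar> < 1" for s by (rule le_less_trans) simp
  have "\<alpha> s = tanh (move x h n - x n)" if "\<bar>s - node n\<bar> \<le> width n" for n s
  proof -
    have "\<alpha> s = (\<Sum>m\<in>{n}. tanh (d m) * bump m s)"
      unfolding \<alpha>_def by (rule suminf_finite) (use bump_off_plateau[OF that] in auto)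
    also have "\<dots> = tanh (move x h n - x n)" by (simp add: bump_plateau[OF that] move_def d_def)
    finally show ?thesis .
  qed
  with cont small show ?thesis by (rule shear_homeomorphic)
qed

section \<open>Recognising the feet\<close>

text \<open>Removing \<open>p\<close> leaves at least \<open>m\<close> pieces that are open and
  closed in the remainder. Continuous functions with values in the natural numbers express this
  without counting components.\<close>

definition splits :: "'a::topological_space set \<Rightarrow> 'a \<Rightarrow> nat \<Rightarrow> bool" where
  "splits K p m \<longleftrightarrow> (\<exists>f :: 'a \<Rightarrow> real. continuous_on (K - {p}) f \<and> f ` (K - {p}) \<subseteq> range real \<and>
     real ` {..<m} \<subseteq> f ` (K - {p}))"

lemma splits_homeomorphism:
  assumes "homeomorphism K L h g" "p \<in> K" "splits K p m"
  shows "splits L (h p) m"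
proof -
  obtain f where f: "continuous_on (K - {p}) f" "f ` (K - {p}) \<subseteq> range real" "real ` {..<m} \<subseteq> f ` (K - {p})"
    using assms(3) unfolding splits_def by blast
  have hg: "\<And>q. q \<in> K \<Longrightarrow> g (h q) = q" "\<And>q. q \<in> L \<Longrightarrow> h (g q) = q" "h ` K = L" "g ` L = K" "continuous_on L g"
    using assms(1) by (auto simp: homeomorphism_def)
  have im: "g ` (L - {h p}) = K - {p}"
  proof
    show "g ` (L - {h p}) \<subseteq> K - {p}" using hg by auto
    show "K - {p} \<subseteq> g ` (L - {h p})"
    proof
      fix q assume q: "q \<in> K - {p}"
      then have "h q \<in> L - {h p}" "g (h q) = q" using hg assms(2) by auto (metis hg(1))
      then show "q \<in> g ` (L - {h p})" by (metis imageI)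
    qed
  qed
  have "continuous_on (L - {h p}) (f \<circ> g)"
    by (rule continuous_on_compose) (use im f(1) continuous_on_subset[OF hg(5)] in auto)
  moreover have "(f \<circ> g) ` (L - {h p}) = f ` (K - {p})" using im by (metis image_comp)
  ultimately show ?thesis unfolding splits_def using f by (intro exI[of _ "f \<circ> g"]) simp
qed

text \<open>A continuous real function with countably many values is constant on connected sets, so
  \<open>m\<close> values need \<open>m\<close> different pieces.\<close>

lemma splits_le:
  assumes "splits K p m" and fin: "finite \<C>" and cover: "K - {p} = \<Union>\<C>"
    and conn: "\<And>C. C \<in> \<C> \<Longrightarrow> connected C"
  shows "m \<le> card \<C>"
proof -
  obtain f where f: "continuous_on (K - {p}) f" "f ` (K - {p}) \<subseteq> range real" "real ` {..<m} \<subseteq> f ` (K - {p})"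
    using assms(1) unfolding splits_def by blast
  have const: "f a = f b" if C: "C \<in> \<C>" "a \<in> C" "b \<in> C" for a b C
  proof (rule ccontr)
    assume ne: "f a \<noteq> f b"
    have CK: "C \<subseteq> K - {p}" using C(1) cover by blast
    have "connected (f ` C)" using conn[OF C(1)] continuous_on_subset[OF f(1) CK] by (rule connected_continuous_image[rotated])
    then have "uncountable (f ` C)" using C(2,3) ne by (intro connected_uncountable[of _ "f a" "f b"]) auto
    moreover have "f ` C \<subseteq> range real" using f(2) CK by blast
    then have "countable (f ` C)" by (rule countable_subset) simp
    ultimately show False by blast
  qed
  have "\<exists>C. C \<in> \<C> \<and> (\<exists>q\<in>C. f q = real i)" if "i < m" for i
  proof -
    have "real i \<in> f ` (K - {p})" using f(3) that by blast
    then obtain q where "q \<in> K - {p}" "f q = real i" by force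
    then show ?thesis unfolding cover by blast
  qed
  then obtain c where c: "\<And>i. i < m \<Longrightarrow> c i \<in> \<C> \<and> (\<exists>q\<in>c i. f q = real i)" by metis
  have "inj_on c {..<m}"
  proof (rule inj_onI)
    fix i j assume ij: "i \<in> {..<m}" "j \<in> {..<m}" "c i = c j"
    obtain a b where "a \<in> c i" "f a = real i" "b \<in> c j" "f b = real j" using c ij by (metis lessThan_iff)
    then have "real i = real j" using const[of "c i" a b] c[of i] ij by auto
    then show "i = j" by simp
  qed
  then have "card {..<m} \<le> card \<C>" by (rule card_inj_on_le) (use c fin in auto)
  then show ?thesis by simp
qed

section \<open>Counting the pieces of the punctured hairy disc\<close>

definition hair_index :: "(nat \<times> nat) set" where
  "hair_index = {(n, j). j < n + 3}"

definition hair_of :: "(nat \<Rightarrow> real) \<Rightarrow> nat \<times> nat \<Rightarrow> real3 set" where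
  "hair_of x i = hair (tanh (x (fst i))) (fst i) (snd i)"

lemma hairy_disc_eq: "hairy_disc x = base \<union> \<Union>(hair_of x ` hair_index)"
  by (auto simp: hairy_disc_def fan_def hair_of_def hair_index_def)

lemma foot_in_hair_of: "foot x (fst i) \<in> hair_of x i"
  unfolding hair_of_def by (rule foot_in_hair)

lemma hair_of_base: "q \<in> hair_of x i \<Longrightarrow> q \<in> base \<Longrightarrow> q = foot x (fst i)"
  unfolding hair_of_def by (erule hair_flat_imp_foot) (auto simp: base_def)

lemma hair_of_meet:
  "q \<in> hair_of x i \<Longrightarrow> q \<in> hair_of x j \<Longrightarrow> i \<in> hair_index \<Longrightarrow> j \<in> hair_index \<Longrightarrow> i \<noteq> j \<Longrightarrow> q = foot x (fst i)"
  unfolding hair_of_def hair_index_def by (rule hairs_meet[of q x "fst i" "snd i" "fst j" "snd j"]) auto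

lemma foot_inj: "foot x n = foot x m \<Longrightarrow> n = m"
  by (auto simp: foot_def dest: node_inj)

lemma connected_with_hairs:
  assumes "connected D" "\<And>i. i \<in> J \<Longrightarrow> foot x (fst i) \<in> D"
  shows "connected (D \<union> \<Union>(hair_of x ` J))"
proof (rule connected_Un_UN[OF assms(1)])
  show "connected X" if "X \<in> hair_of x ` J" for X
    using that convex_connected[OF convex_hair] by (auto simp: hair_of_def)
  show "D \<inter> X \<noteq> {}" if "X \<in> hair_of x ` J" for X
    using that assms(2) foot_in_hair_of by blast
qed

lemma convex_base: "convex base"
  unfolding base_def by (intro convex_Times) auto

lemma connected_punctured_base: "connected (base - {p})"
proof (rule connected_convex_diff_countable[OF convex_base])
  show "\<not> collinear base"
  proof
    assume "collinear base"
    then obtain u where u: "\<And>x y. x \<in> base \<Longrightarrow> y \<in> base \<Longrightarrow> \<exists>c. x - y = c *\<^sub>R u"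
      unfolding collinear_def by blast
    have b: "(0, 0, 0) \<in> base" "(1, 0, 0) \<in> base" "(0, 1, 0) \<in> base" by (auto simp: base_def)
    obtain c where c: "(1, 0, 0) - (0, 0, 0) = c *\<^sub>R u" using u[OF b(2,1)] by blast
    obtain d where d: "(0, 1, 0) - (0, 0, 0) = d *\<^sub>R u" using u[OF b(3,1)] by blast
    from c d show False by (cases u) auto
  qed
qed simp

lemma connected_hair_segment:
  assumes "connected S" shows "connected (hair_point t n j ` S)"
  by (rule connected_continuous_image[OF continuous_on_hair_point assms])

lemma hair_minus_foot: "hair (tanh (x n)) n j - {foot x n} = hair_point (tanh (x n)) n j ` {0<..width n}"
  unfolding hair_point_0[symmetric, of x n j] hair_def by (auto simp: hair_point_def)

lemma foot_splits: "splits (hairy_disc x) (foot x n) (n + 4)"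
proof -
  define A where "A = (hairy_disc x - {foot x n}) \<inter> fan (tanh (x n)) n"
  \<comment> \<open>Other fans keep away from node \<open>n\<close> by more than
    \<open>2 * width n\<close>, so this relatively closed set catches everything outside fan
    \<open>n\<close>.\<close>
  define B where "B = (hairy_disc x - {foot x n}) \<inter> {q. 2 * width n \<le> \<bar>fst q - node n\<bar> \<or> snd (snd q) \<le> 0}"
  \<comment> \<open>The fraction recovers the slope: on the punctured hairy disc, \<open>f\<close>
    is \<open>1 + j\<close> on hair \<open>j\<close> of fan \<open>n\<close> and 0
    elsewhere.\<close>
  define f where "f q = (if snd (snd q) > 0 \<and> \<bar>fst q - node n\<bar> < width n then 1 + (real n + 3) * (fst q - node n) / snd (snd q) else 0)" for q :: real3
  have posA: "snd (snd q) > 0 \<and> \<bar>fst q - node n\<bar> < width n" if "q \<in> A" for q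
  proof -
    obtain j where j: "j < n + 3" "q \<in> hair (tanh (x n)) n j" "q \<noteq> foot x n" using \<open>q \<in> A\<close> by (auto simp: A_def fan_def)
    then have "snd (snd q) \<noteq> 0" using hair_flat_imp_foot by blast
    then show ?thesis using hair_nth[OF j(2,1)] by simp
  qed
  have notB: "\<not> (snd (snd q) > 0 \<and> \<bar>fst q - node n\<bar> < width n)" if "q \<in> B" for q
    using that width_pos[of n] by (auto simp: B_def)
  have AB: "hairy_disc x - {foot x n} = A \<union> B"
  proof
    show "hairy_disc x - {foot x n} \<subseteq> A \<union> B"
    proof
      fix q assume q: "q \<in> hairy_disc x - {foot x n}"
      show "q \<in> A \<union> B"
      proof (cases "q \<in> base")
        case True
        then show ?thesis using q by (auto simp: B_def base_def)
      next
        case False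
        with q obtain m where m: "q \<in> fan (tanh (x m)) m" by (auto simp: hairy_disc_def)
        show ?thesis
        proof (cases "m = n")
          case False
          then have "\<not> \<bar>fst q - node n\<bar> \<le> 2 * width n"
            using node_separated[of "fst q" m n] fan_nth(1)[OF m] width_pos[of m] by auto
          then show ?thesis using q by (auto simp: B_def)
        qed (use m q in \<open>auto simp: A_def\<close>)
      qed
    qed
  qed (auto simp: A_def B_def)
  have "continuous_on (A \<union> B) f"
    unfolding f_def
  proof (rule continuous_on_cases_local)
    have "closedin (top_of_set (hairy_disc x - {foot x n})) A"
      unfolding A_def by (rule closedin_closed_Int[OF compact_imp_closed[OF compact_fan]])
    then show "closedin (top_of_set (A \<union> B)) A" by (simp add: AB)
    have "closed {q::real3. 2 * width n \<le> \<bar>fst q - node n\<bar> \<or> snd (snd q) \<le> 0}"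
      by (intro closed_Collect_disj closed_Collect_le continuous_intros)
    then have "closedin (top_of_set (hairy_disc x - {foot x n})) B"
      unfolding B_def by (rule closedin_closed_Int)
    then show "closedin (top_of_set (A \<union> B)) B" by (simp add: AB)
    show "continuous_on A (\<lambda>q. 1 + (real n + 3) * (fst q - node n) / snd (snd q))"
      by (intro continuous_intros) (use posA in fastforce)
  qed (use posA notB in auto)
  then have cont: "continuous_on (hairy_disc x - {foot x n}) f" by (simp add: AB)
  have val: "f q = real (1 + j)" if q: "q \<in> hair (tanh (x n)) n j" "j < n + 3" "q \<noteq> foot x n" for q j
  proof -
    have "q \<in> A" using q by (auto simp: A_def fan_def hairy_disc_def)
    note p = posA[OF this]
    have "real n + 3 \<noteq> 0" by linarith
    then have "(real n + 3) * (fst q - node n) / snd (snd q) = real j"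
      using hair_nth(5)[OF q(1,2)] p by (simp add: field_simps)
    then show ?thesis using p by (simp add: f_def)
  qed
  have "f ` (hairy_disc x - {foot x n}) \<subseteq> range real"
  proof
    fix v assume "v \<in> f ` (hairy_disc x - {foot x n})"
    then obtain q where q: "q \<in> A \<union> B" "v = f q" using AB by blast
    show "v \<in> range real"
    proof (cases "q \<in> A")
      case True
      then obtain j where "j < n + 3" "q \<in> hair (tanh (x n)) n j" "q \<noteq> foot x n" by (auto simp: A_def fan_def)
      then show ?thesis using val q(2) by blast
    next
      case False
      then have "f q = 0" using q(1) notB[of q] by (auto simp: f_def)
      then show ?thesis using q(2) by (metis of_nat_0 rangeI)
    qed
  qed
  moreover have "real ` {..<n + 4} \<subseteq> f ` (hairy_disc x - {foot x n})"
  proof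
    fix v assume "v \<in> real ` {..<n + 4}"
    then obtain i where i: "i < n + 4" "v = real i" by auto
    show "v \<in> f ` (hairy_disc x - {foot x n})"
    proof (cases i)
      case 0
      have "(0, 0, 0) \<in> hairy_disc x - {foot x n}"
        using node_pos[of n] by (auto simp: hairy_disc_def base_def foot_def simp del: node_pos)
      moreover have "f (0, 0, 0) = 0" by (simp add: f_def)
      ultimately show ?thesis using 0 i(2) by (metis imageI of_nat_0)
    next
      case (Suc j)
      let ?q = "hair_point (tanh (x n)) n j (width n)"
      have "?q \<in> hair (tanh (x n)) n j" by (auto simp: hair_def)
      moreover have "?q \<noteq> foot x n" by (simp add: hair_point_def foot_def)
      moreover have "j < n + 3" using Suc i(1) by simp
      ultimately have "f ?q = v" "?q \<in> hairy_disc x - {foot x n}"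
        using val[of ?q j] Suc i(2) by (auto simp: hairy_disc_def fan_def)
      then show ?thesis by blast
    qed
  qed
  ultimately show ?thesis unfolding splits_def using cont by blast
qed

text \<open>Few connected pieces cover the remainder: at foot \<open>k\<close> the rest and
  \<open>k + 3\<close> hairs, at any other point of the base one piece, and on a hair away from its
  foot two.\<close>

lemma splits_imp_foot:
  assumes p: "p \<in> hairy_disc x" and m: "splits (hairy_disc x) p m" "3 \<le> m"
  shows "\<exists>k. p = foot x k \<and> m \<le> k + 4"
proof (cases "\<exists>k. p = foot x k")
  case True
  then obtain k where k: "p = foot x k" by blast
  define J where "J = {i\<in>hair_index. fst i \<noteq> k}"
  have J_eq: "hair_index = J \<union> Pair k ` {..<k+3}" by (auto simp: J_def hair_index_def)
  let ?M = "(base - {p}) \<union> \<Union>(hair_of x ` J)"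
  let ?H = "(\<lambda>j. hair_of x (k, j) - {p}) ` {..<k+3}"
  have "m \<le> card (insert ?M ?H)"
  proof (rule splits_le[OF m(1)])
    have "connected ?M"
      by (rule connected_with_hairs[OF connected_punctured_base])
         (use foot_in_base foot_inj in \<open>auto simp: k J_def\<close>)
    moreover have "connected (hair_of x (k, j) - {p})" for j
      by (simp add: hair_of_def k hair_minus_foot connected_hair_segment)
    ultimately show "connected C" if "C \<in> insert ?M ?H" for C using that by auto
    have "p \<notin> hair_of x i" if "i \<in> J" for i
      using hair_of_base[of p x i] foot_in_base[of x k] foot_inj[of x k "fst i"] that k by (auto simp: J_def)
    then have "\<Union>(hair_of x ` J) - {p} = \<Union>(hair_of x ` J)" by blast
    moreover have "hairy_disc x = base \<union> \<Union>(hair_of x ` J) \<union> (\<Union>j<k+3. hair_of x (k, j))"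
      unfolding hairy_disc_eq J_eq image_Un Union_Un_distrib image_image by (simp only: Un_assoc)
    ultimately show "hairy_disc x - {p} = \<Union>(insert ?M ?H)" by (auto simp: Un_Diff)
  qed simp
  also have "\<dots> \<le> Suc (card ?H)" by (simp add: card_insert_le_m1 card_insert_if)
  also have "\<dots> \<le> k + 4" using card_image_le[of "{..<k+3}" "\<lambda>j. hair_of x (k, j) - {p}"] by simp
  finally show ?thesis using k by blast
next
  case False
  have "m \<le> 2"
  proof (cases "p \<in> base")
    case True
    have "m \<le> card {(base - {p}) \<union> \<Union>(hair_of x ` hair_index)}"
    proof (rule splits_le[OF m(1)])
      have "connected ((base - {p}) \<union> \<Union>(hair_of x ` hair_index))"
        by (rule connected_with_hairs[OF connected_punctured_base]) (use False foot_in_base in blast)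
      then show "connected C" if "C \<in> {(base - {p}) \<union> \<Union>(hair_of x ` hair_index)}" for C
        using that by simp
      have "p \<notin> hair_of x i" for i using False True hair_of_base by blast
      then show "hairy_disc x - {p} = \<Union>{(base - {p}) \<union> \<Union>(hair_of x ` hair_index)}"
        unfolding hairy_disc_eq by blast
    qed simp
    then show ?thesis by simp
  next
    case notbase: False
    then obtain i where i: "i \<in> hair_index" "p \<in> hair_of x i" using p by (auto simp: hairy_disc_eq)
    obtain n j where nj: "i = (n, j)" by fastforce
    let ?h = "hair_point (tanh (x n)) n j"
    obtain u where u: "u \<in> {0..width n}" "p = ?h u" using i(2) by (auto simp: hair_of_def hair_def nj)
    have "u \<noteq> 0" using u(2) False hair_point_0[of x n j] by metis
    then have u0: "0 < u" using u(1) by simp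
    let ?D = "base \<union> \<Union>(hair_of x ` (hair_index - {i}))"
    have inj: "?h v = ?h w \<longleftrightarrow> v = w" for v w by (auto simp: hair_point_def)
    \<comment> \<open>The hair is cut at height \<open>u\<close>; its lower part hangs on to the
      rest through the foot. At the tip the upper part is empty.\<close>
    have "m \<le> card {?D \<union> ?h ` {0..<u}, ?h ` {u<..width n}}"
    proof (rule splits_le[OF m(1)])
      have D: "connected ?D"
        by (rule connected_with_hairs) (use foot_in_base convex_base convex_connected in auto)
      have "foot x n \<in> ?D \<inter> ?h ` {0..<u}"
        using u0 foot_in_base hair_point_0[of x n j] by force
      then have "connected (?D \<union> ?h ` {0..<u})"
        by (intro connected_Un D connected_hair_segment) auto
      moreover have "connected (?h ` {u<..width n})" by (intro connected_hair_segment) simp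
      ultimately show "connected C" if "C \<in> {?D \<union> ?h ` {0..<u}, ?h ` {u<..width n}}" for C using that by auto
      have "p \<notin> hair_of x i'" if "i' \<in> hair_index - {i}" for i'
        using hair_of_meet[of p x i i'] i that False by auto
      then have pD: "p \<notin> ?D" using notbase by blast
      have "hair_of x i - {p} = ?h ` ({0..width n} - {u})"
        unfolding hair_of_def hair_def nj u(2) using inj by auto
      also have "{0..width n} - {u} = {0..<u} \<union> {u<..width n}" using u by auto
      finally have hi: "hair_of x i - {p} = ?h ` {0..<u} \<union> ?h ` {u<..width n}" by (simp add: image_Un)
      have "hairy_disc x - {p} = ?D \<union> (hair_of x i - {p})"
        using pD i(1) unfolding hairy_disc_eq by blast
      then show "hairy_disc x - {p} = \<Union>{?D \<union> ?h ` {0..<u}, ?h ` {u<..width n}}"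
        unfolding hi by (simp only: Union_insert Union_empty Un_empty_right Un_assoc)
    qed simp
    also have "\<dots> \<le> 2" by (simp add: card_insert_if)
    finally show ?thesis .
  qed
  with m(2) show ?thesis by simp
qed

text \<open>The number of pieces cannot drop under \<open>h\<close>, so foot \<open>n\<close> goes
  to a foot \<open>k\<close> with \<open>n \<le> k\<close>; the inverse homeomorphism gives
  \<open>k \<le> n\<close>.\<close>

lemma homeomorphism_foot:
  assumes "homeomorphism (hairy_disc x) (hairy_disc y) h g"
  shows "h (foot x n) = foot y n"
proof -
  have maps: "\<And>q. q \<in> hairy_disc x \<Longrightarrow> h q \<in> hairy_disc y \<and> g (h q) = q"
    using assms by (auto simp: homeomorphism_def)
  have fx: "foot z k \<in> hairy_disc z" for z k using foot_in_base by (simp add: hairy_disc_def)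
  have "splits (hairy_disc y) (h (foot x n)) (n + 4)"
    by (rule splits_homeomorphism[OF assms fx foot_splits])
  then obtain k where k: "h (foot x n) = foot y k" "n + 4 \<le> k + 4"
    using splits_imp_foot[of "h (foot x n)" y "n + 4"] maps[OF fx] by auto
  have "splits (hairy_disc x) (g (foot y k)) (k + 4)"
    by (rule splits_homeomorphism[OF homeomorphism_symD[OF assms] fx foot_splits])
  then have "splits (hairy_disc x) (foot x n) (k + 4)" using k(1) maps[OF fx[where z = x and k = n]] by metis
  then obtain l where "foot x n = foot x l" "k + 4 \<le> l + 4" using splits_imp_foot[OF fx] by force
  then have "k = n" using foot_inj[of x n l] k(2) by simp
  then show ?thesis using k(1) by simp
qed

lemma foot_tendsto:
  assumes \<nu>: "\<And>N. N \<le> \<nu> N" and z: "\<And>N. \<bar>z (\<nu> N)\<bar> < 1 / (real N + 1)"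
  shows "(\<lambda>N. foot z (\<nu> N)) \<longlonglongrightarrow> (0, 0, 0)"
proof -
  have z0: "(\<lambda>N. z (\<nu> N)) \<longlonglongrightarrow> 0"
  proof (rule Lim_null_comparison)
    show "\<forall>\<^sub>F N in sequentially. norm (z (\<nu> N)) \<le> 1 / (real N + 1)" using z by (simp add: less_imp_le)
    show "(\<lambda>N. 1 / (real N + 1)) \<longlonglongrightarrow> 0" using LIMSEQ_inverse_real_of_nat by (simp add: inverse_eq_divide add.commute)
  qed
  have "(\<lambda>N. node (\<nu> N)) \<longlonglongrightarrow> 0"
    by (rule filterlim_compose[OF node_tendsto]) (use \<nu> in \<open>auto intro: filterlim_at_top_mono[OF filterlim_ident]\<close>)
  moreover have "(\<lambda>N. tanh (z (\<nu> N))) \<longlonglongrightarrow> tanh 0" by (intro tendsto_intros z0) simp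
  ultimately have "(\<lambda>N. foot z (\<nu> N)) \<longlonglongrightarrow> (0, tanh 0, 0)" unfolding foot_def by (intro tendsto_Pair tendsto_const)
  then show ?thesis by simp
qed

text \<open>Along indices where both sequences are small, both families of feet tend to the origin,
  so a homeomorphism fixes it. Along indices where \<open>x\<close> is small but \<open>y\<close>
  exceeds 1, this contradicts continuity.\<close>

lemma not_homeomorphic_hairy_disc:
  assumes same: "\<And>N::nat. \<exists>n\<ge>N. \<bar>x n\<bar> < 1 / (real N + 1) \<and> \<bar>y n\<bar> < 1 / (real N + 1)"
    and diff: "\<And>N::nat. \<exists>n\<ge>N. \<bar>x n\<bar> < 1 / (real N + 1) \<and> 1 < y n"
  shows "\<not> hairy_disc x homeomorphic hairy_disc y"
proof
  assume "hairy_disc x homeomorphic hairy_disc y"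
  then obtain h g where hom: "homeomorphism (hairy_disc x) (hairy_disc y) h g" unfolding homeomorphic_def by blast
  then have cont: "continuous_on (hairy_disc x) h" by (simp add: homeomorphism_def)
  have 0: "(0, 0, 0) \<in> hairy_disc x" by (simp add: hairy_disc_def base_def)
  have lim: "(\<lambda>N. foot y (\<nu> N)) \<longlonglongrightarrow> h (0, 0, 0)" if "(\<lambda>N. foot x (\<nu> N)) \<longlonglongrightarrow> (0, 0, 0)" for \<nu>
  proof -
    have "(\<lambda>N. h (foot x (\<nu> N))) \<longlonglongrightarrow> h (0, 0, 0)"
      by (rule continuous_on_tendsto_compose[OF cont that 0]) (use foot_in_base in \<open>auto simp: hairy_disc_def\<close>)
    then show ?thesis by (simp add: homeomorphism_foot[OF hom])
  qed
  obtain \<nu> where \<nu>: "\<And>N. N \<le> \<nu> N" "\<And>N. \<bar>x (\<nu> N)\<bar> < 1 / (real N + 1)" "\<And>N. \<bar>y (\<nu> N)\<bar> < 1 / (real N + 1)"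
    using same by metis
  have "h (0, 0, 0) = (0, 0, 0)"
    using LIMSEQ_unique[OF lim[OF foot_tendsto[OF \<nu>(1,2)]] foot_tendsto[OF \<nu>(1,3)]] .
  moreover obtain \<mu> where \<mu>: "\<And>N. N \<le> \<mu> N" "\<And>N. \<bar>x (\<mu> N)\<bar> < 1 / (real N + 1)" "\<And>N. 1 < y (\<mu> N)"
    using diff by metis
  ultimately have "(\<lambda>N. foot y (\<mu> N)) \<longlonglongrightarrow> (0, 0, 0)" using lim[OF foot_tendsto[OF \<mu>(1,2)]] by simp
  then have "(\<lambda>N. fst (snd (foot y (\<mu> N)))) \<longlonglongrightarrow> fst (snd (0::real, 0::real, 0::real))" by (intro tendsto_intros)
  then have "(\<lambda>N. tanh (y (\<mu> N))) \<longlonglongrightarrow> 0" by (simp add: foot_def)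
  moreover have "tanh 1 \<le> tanh (y (\<mu> N))" for N using \<mu>(3)[of N] by simp
  ultimately have "tanh 1 \<le> (0::real)" by (intro LIMSEQ_le_const) auto
  then show False by simp
qed

section \<open>Non-classifiability\<close>

text \<open>An open set constrains only finitely many coordinates, so a later coordinate from the
  infinite set \<open>I\<close> can be chosen at will.\<close>

lemma eventually_generic_hits:
  fixes I :: "nat set" and a b :: real
  assumes I: "infinite I" and "a < b"
  shows "eventually (\<lambda>y :: nat \<Rightarrow> real. \<exists>n\<in>I. a < y n \<and> y n < b) generic"
proof -
  let ?U = "\<Union>n\<in>I. {y :: nat \<Rightarrow> real. a < y n \<and> y n < b}"
  have "eventually (\<lambda>y. y \<in> ?U) generic"
  proof (rule eventually_generic_dense_open)
    show "open ?U"
      by (intro open_UN ballI open_Collect_conj open_Collect_less continuous_on_const continuous_on_product_coordinates)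
    show "closure ?U = UNIV" unfolding closure_UNIV_iff
    proof (intro allI impI)
      fix S :: "(nat \<Rightarrow> real) set" assume S: "open S" "S \<noteq> {}"
      then obtain z where z: "z \<in> S" by blast
      obtain N \<epsilon> where N: "\<epsilon> > 0" "{x. \<forall>i<N. \<bar>x i - z i\<bar> < \<epsilon>} \<subseteq> S"
        by (rule open_fun_contains_box[OF S(1) z])
      obtain n where n: "n \<in> I" "N \<le> n" using I infinite_nat_iff_unbounded_le by blast
      have "z(n := (a + b) / 2) \<in> S" using N n(2) by auto
      moreover have "z(n := (a + b) / 2) \<in> ?U" using n(1) \<open>a < b\<close> by auto
      ultimately show "S \<inter> ?U \<noteq> {}" by blast
    qed
  qed
  then show ?thesis by eventually_elim blast
qed

lemma ex_not_homeomorphic_hairy_disc: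
  assumes C: "eventually (\<lambda>x. x \<in> C) generic"
  obtains x y where "x \<in> C" "y \<in> C" "\<not> hairy_disc x homeomorphic hairy_disc y"
proof -
  have "eventually (\<lambda>x :: nat \<Rightarrow> real. \<exists>n\<in>{N..}. - (1 / (real N + 1)) < x n \<and> x n < 1 / (real N + 1)) generic" for N
  proof (rule eventually_generic_hits)
    have "0 < 1 / (real N + 1)" by simp
    then show "- (1 / (real N + 1)) < 1 / (real N + 1)" by linarith
  qed (simp add: infinite_Ici)
  then have "eventually (\<lambda>x :: nat \<Rightarrow> real. \<forall>N. \<exists>n\<in>{N..}. - (1 / (real N + 1)) < x n \<and> x n < 1 / (real N + 1)) generic"
    by (rule eventually_generic_countable_all)
  from eventually_conj[OF C this]
  obtain x where "x \<in> C \<and> (\<forall>N. \<exists>n\<in>{N..}. - (1 / (real N + 1)) < x n \<and> x n < 1 / (real N + 1))"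
    by (rule generic_exists_in_open[OF _ open_UNIV UNIV_not_empty])
  note x = this[THEN conjunct1] this[THEN conjunct2]
  have small: "\<exists>n\<ge>N. \<bar>x n\<bar> < 1 / (real N + 1)" for N
    using x(2)[rule_format, of N] by (auto simp: abs_less_iff minus_less_iff)
  \<comment> \<open>\<open>x\<close> is chosen first; \<open>y\<close> is then generic relative to
    these infinite sets of indices at which \<open>x\<close> is small.\<close>
  define I where "I N = {n. N \<le> n \<and> \<bar>x n\<bar> < 1 / (real N + 1)}" for N
  have I: "infinite (I N)" for N
    unfolding infinite_nat_iff_unbounded_le
  proof
    fix m
    obtain n where n: "max N m \<le> n" "\<bar>x n\<bar> < 1 / (real (max N m) + 1)" using small by blast
    have "1 / (real (max N m) + 1) \<le> 1 / (real N + 1)" by (intro divide_left_mono) auto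
    then have "n \<in> I N" using n by (simp add: I_def)
    then show "\<exists>n\<ge>m. n \<in> I N" using n(1) by auto
  qed
  have "eventually (\<lambda>y. \<forall>N. (\<exists>n\<in>I N. - (1 / (real N + 1)) < y n \<and> y n < 1 / (real N + 1)) \<and> (\<exists>n\<in>I N. 1 < y n \<and> y n < 2)) generic"
  proof (intro eventually_generic_countable_all eventually_conj eventually_generic_hits I)
    fix N :: nat
    have "0 < 1 / (real N + 1)" by simp
    then show "- (1 / (real N + 1)) < 1 / (real N + 1)" by linarith
  qed simp
  from eventually_conj[OF C this]
  obtain y where "y \<in> C \<and> (\<forall>N. (\<exists>n\<in>I N. - (1 / (real N + 1)) < y n \<and> y n < 1 / (real N + 1)) \<and> (\<exists>n\<in>I N. 1 < y n \<and> y n < 2))"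
    by (rule generic_exists_in_open[OF _ open_UNIV UNIV_not_empty])
  note y = this[THEN conjunct1] this[THEN conjunct2]
  have "\<not> hairy_disc x homeomorphic hairy_disc y"
  proof (rule not_homeomorphic_hairy_disc)
    show "\<exists>n\<ge>N. \<bar>x n\<bar> < 1 / (real N + 1) \<and> \<bar>y n\<bar> < 1 / (real N + 1)" for N
      using y(2)[rule_format, of N] by (auto simp: I_def abs_less_iff minus_less_iff)
    show "\<exists>n\<ge>N. \<bar>x n\<bar> < 1 / (real N + 1) \<and> 1 < y n" for N
      using y(2)[rule_format, of N] by (auto simp: I_def)
  qed
  with x(1) y(1) show ?thesis by (rule that)
qed

theorem theorem4p2:
  fixes ar :: "'l::countable \<Rightarrow> nat"
  shows "\<not> homeo_AR_R3_borel_reducible ar"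
proof
  assume "homeo_AR_R3_borel_reducible ar"
  then obtain f where f: "f \<in> measurable (restrict_space (borel_of vietoris) AR_R3) (struct_measure ar)"
    and red: "\<And>K L. K \<in> AR_R3 \<Longrightarrow> L \<in> AR_R3 \<Longrightarrow> K homeomorphic L \<longleftrightarrow> struct_iso ar (f K) (f L)"
    unfolding homeo_AR_R3_borel_reducible_def by blast
  \<comment> \<open>The reduction is pulled back along \<open>hairy_AR\<close> to sequences of
    reals, on which the moves act.\<close>
  define g where "g x = f (hairy_AR x)" for x
  have g: "g \<in> measurable borel (struct_measure ar)"
    using measurable_comp[OF hairy_AR_measurable f] by (simp add: g_def[abs_def] comp_def)
  have struct: "{{M \<in> struct_space ar. M r xs} | r xs. length xs = ar r} \<subseteq> Pow (struct_space ar)" by blast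
  have iso_iff: "struct_iso ar (g x) (g y) \<longleftrightarrow> hairy_disc x homeomorphic hairy_disc y" for x y
    using red[OF hairy_AR_in_AR_R3 hairy_AR_in_AR_R3, of x y] hairy_AR_homeomorphic[of x] hairy_AR_homeomorphic[of y]
    unfolding g_def by (meson homeomorphic_sym homeomorphic_trans)
  have gs: "g x \<in> struct_space ar" for x
    using measurable_space[OF g, of x] struct by (simp add: struct_measure_def space_measure_of_conv)
  interpret generic_homomorphism ar g
  proof
    fix r xs
    show "{x. g x r xs} \<in> sets borel"
    proof (cases "length xs = ar r")
      case True
      have "{M \<in> struct_space ar. M r xs} \<in> sets (struct_measure ar)"
        unfolding struct_measure_def sets_measure_of[OF struct] using True by (intro sigma_sets.Basic) blast
      from measurable_sets[OF g this] show ?thesis using gs by (simp add: vimage_def)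
    next
      \<comment> \<open>Members of \<open>struct_space ar\<close> hold only on lists of the right
        length, so this set is empty.\<close>
      case False
      then have "{x. g x r xs} = {}" using gs by (auto simp: struct_space_def)
      then show ?thesis by simp
    qed
    show "struct_iso ar (g x) (g (move x h))" for x h
      unfolding iso_iff by (rule hairy_disc_move)
  qed
  \<comment> \<open>All structures over the comeager set \<open>C\<close> are isomorphic, although
    two of the spaces over \<open>C\<close> are not homeomorphic.\<close>
  obtain C where C: "eventually (\<lambda>x. x \<in> C) generic" "\<forall>x\<in>C. \<forall>y\<in>C. struct_iso ar (g x) (g y)"
    using generically_isomorphic by blast
  obtain x y where "x \<in> C" "y \<in> C" "\<not> hairy_disc x homeomorphic hairy_disc y"
    by (rule ex_not_homeomorphic_hairy_disc[OF C(1)])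
  then show False using C(2) iso_iff by blast
qed

end
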